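(* Let $r$ be a positive integer. If $P$ is a C-shellable $r$-cubical poset, then the chain polynomial of $P$, and the chain polynomial of any rank-selected subposet $P_S=\{x\in P:\rho(x)\in S\}$ with $S\subseteq\mathbb{N}$, is real-rooted.
   Context: $r$-cubical posets: let $M_r$ be the poset consisting of an antichain $[r]=\{1,\dots,r\}$ together with a largest element $z$. The infinite $r$-cubical lattice $\mathbf{C}_r$ consists of a least element $\hat0$ together with all sequences $x=(\xi_1,\xi_2,\dots)$ with $\xi_i\in M_r$ and $\xi_i\in[r]$ for all but finitely many $i$, ordered coordinatewise. The rank of a sequence $x$ is $\rho(x)=1+|\{i:\xi_i=z\}|$ and $\rho(\hat0)=0$. For $x\in\mathbf{C}_r$ of rank $n$, the interval $[\hat0,x]$ is an $r$-cube of rank $n$. A finite poset $P$ with a least element $\hat0$ is $r$-cubical if every principal order ideal $\langle x\rangle=\{z'\in P:z'\le x\}$ is isomorphic to an $r$-cube; $\rho(x)$ is the rank of that cube and the rank $\rho(P)$ of $P$ is the maximal rank of an element. C-shellability: a finite poset is pure if all its maximal chains have the same length; facets are maximal elements. Let $P$ be a pure poset with least element $\hat0$. An ordering $x_1,\dots,x_m$ of the facets of $P$ is a C-shelling if $P$ has rank at most one, or the rank of $P$ is at least two and (S1) for each $j>1$, the subposet $H_j=\langle x_j\rangle\cap\bigcup_{i<j}\langle x_i\rangle$ of $\langle x_j\rangle$ is pure of rank $\rho(P)-1$; and (S2) for each $j$, $[\hat0,x_j)=\{x\in P:x<x_j\}$ has a C-shelling, and if $j>1$ it has a C-shelling for which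 the facets of $H_j$ come first. $P$ is C-shellable if it is pure and has a C-shelling. The chain polynomial of a finite poset $Q$ is $c_Q(t)=\sum_C t^{|C|}$, the sum over all chains $C$ in $Q$ (including the empty one). Real-rooted means all complex zeros are real (nonzero constants count as real-rooted). *)

theory Defs
  imports Complex_Main "HOL-Computational_Algebra.Computational_Algebra"
begin

text \<open>
  A poset is a carrier set \<open>P\<close> with a relation \<open>le\<close>; only the restriction of \<open>le\<close> to \<open>P\<close>
  matters, so a subposet is a subset of \<open>P\<close> with the same \<open>le\<close>.
\<close>

definition finite_poset :: "('a \<Rightarrow> 'a \<Rightarrow> bool) \<Rightarrow> 'a set \<Rightarrow> bool" where
  "finite_poset le P \<longleftrightarrow> finite P \<and> partial_order_on P (relation_of le P)"

definition has_least :: "('a \<Rightarrow> 'a \<Rightarrow> bool) \<Rightarrow> 'a set \<Rightarrow> bool" where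
  "has_least le P \<longleftrightarrow> (\<exists>b\<in>P. \<forall>x\<in>P. le b x)"

definition order_isomorphic ::
  "('a \<Rightarrow> 'a \<Rightarrow> bool) \<Rightarrow> 'a set \<Rightarrow> ('b \<Rightarrow> 'b \<Rightarrow> bool) \<Rightarrow> 'b set \<Rightarrow> bool" where
  "order_isomorphic le P le' Q \<longleftrightarrow>
     (\<exists>f. bij_betw f P Q \<and> (\<forall>x\<in>P. \<forall>y\<in>P. le x y \<longleftrightarrow> le' (f x) (f y)))"

definition ideal_below :: "('a \<Rightarrow> 'a \<Rightarrow> bool) \<Rightarrow> 'a set \<Rightarrow> 'a \<Rightarrow> 'a set" where
  "ideal_below le P x = {y \<in> P. le y x}"

definition strictly_below :: "('a \<Rightarrow> 'a \<Rightarrow> bool) \<Rightarrow> 'a set \<Rightarrow> 'a \<Rightarrow> 'a set" where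
  "strictly_below le P x = {y \<in> P. le y x \<and> y \<noteq> x}"

definition facets :: "('a \<Rightarrow> 'a \<Rightarrow> bool) \<Rightarrow> 'a set \<Rightarrow> 'a set" where
  "facets le P = {x \<in> P. \<forall>y\<in>P. le x y \<longrightarrow> y = x}"

definition pure :: "('a \<Rightarrow> 'a \<Rightarrow> bool) \<Rightarrow> 'a set \<Rightarrow> bool" where
  "pure le P \<longleftrightarrow>
     (\<forall>C D. pred_on.maxchain P le C \<longrightarrow> pred_on.maxchain P le D \<longrightarrow> card C = card D)"

text \<open>
  The length of a longest chain, where a chain of \<open>k + 1\<close> elements has length \<open>k\<close>.  For an
  \<open>r\<close>-cubical poset this is the maximal rank of an element.
\<close>

definition poset_rank :: "('a \<Rightarrow> 'a \<Rightarrow> bool) \<Rightarrow> 'a set \<Rightarrow> nat" where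
  "poset_rank le P = Max {card C |C. pred_on.chain P le C} - 1"


subsection \<open>Cubical posets\<close>

text \<open>The ambient type of \<open>M\<^sub>r\<close>; \<open>Z\<close> is its largest element \<open>z\<close>.\<close>

datatype letter = Atom nat | Z

definition M :: "nat \<Rightarrow> letter set" where
  "M r = insert Z (Atom ` {1..r})"

definition letter_le :: "letter \<Rightarrow> letter \<Rightarrow> bool" where
  "letter_le a b \<longleftrightarrow> a = b \<or> b = Z"

text \<open>\<open>Bot\<close> is the adjoined least element; sequences are indexed from \<open>0\<close>.\<close>

datatype cub = Bot | Seq "nat \<Rightarrow> letter"

definition C_inf :: "nat \<Rightarrow> cub set" where
  "C_inf r = insert Bot
     (Seq ` {\<xi>. (\<forall>i. \<xi> i \<in> M r) \<and> finite {i. \<xi> i \<notin> Atom ` {1..r}}})"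

fun cub_le :: "cub \<Rightarrow> cub \<Rightarrow> bool" where
  "cub_le Bot y = True"
| "cub_le (Seq \<xi>) Bot = False"
| "cub_le (Seq \<xi>) (Seq \<eta>) = (\<forall>i. letter_le (\<xi> i) (\<eta> i))"

fun cub_rank :: "cub \<Rightarrow> nat" where
  "cub_rank Bot = 0"
| "cub_rank (Seq \<xi>) = 1 + card {i. \<xi> i = Z}"

definition is_cube :: "nat \<Rightarrow> nat \<Rightarrow> ('a \<Rightarrow> 'a \<Rightarrow> bool) \<Rightarrow> 'a set \<Rightarrow> bool" where
  "is_cube r n le Q \<longleftrightarrow>
     (\<exists>x\<in>C_inf r. cub_rank x = n \<and>
        order_isomorphic le Q cub_le (ideal_below cub_le (C_inf r) x))"

definition cubical :: "nat \<Rightarrow> ('a \<Rightarrow> 'a \<Rightarrow> bool) \<Rightarrow> 'a set \<Rightarrow> bool" where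
  "cubical r le P \<longleftrightarrow>
     finite_poset le P \<and> has_least le P \<and>
     (\<forall>x\<in>P. \<exists>n. is_cube r n le (ideal_below le P x))"

text \<open>
  For \<open>r > 0\<close> an \<open>r\<close>-cube of rank \<open>n > 0\<close> has \<open>1 + (r + 1) ^ (n - 1)\<close> elements, and one of rank
  \<open>0\<close> has one element, so the rank of a cube is unique.
\<close>

definition elem_rank :: "nat \<Rightarrow> ('a \<Rightarrow> 'a \<Rightarrow> bool) \<Rightarrow> 'a set \<Rightarrow> 'a \<Rightarrow> nat" where
  "elem_rank r le P x = (THE n. is_cube r n le (ideal_below le P x))"

definition rank_selected ::
  "nat \<Rightarrow> ('a \<Rightarrow> 'a \<Rightarrow> bool) \<Rightarrow> 'a set \<Rightarrow> nat set \<Rightarrow> 'a set" where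
  "rank_selected r le P S = {x \<in> P. elem_rank r le P x \<in> S}"


subsection \<open>C-shellability\<close>

definition shelling_intersection ::
  "('a \<Rightarrow> 'a \<Rightarrow> bool) \<Rightarrow> 'a set \<Rightarrow> 'a list \<Rightarrow> nat \<Rightarrow> 'a set" where
  "shelling_intersection le P xs j =
     ideal_below le P (xs ! j) \<inter> (\<Union>i<j. ideal_below le P (xs ! i))"

text \<open>
  The definition recurses from \<open>P\<close> to posets of smaller rank, so the least fixed point is the
  only one.  List positions start at \<open>0\<close>: the condition \<open>j > 1\<close> on facets \<open>x\<^sub>1, \<dots>, x\<^sub>m\<close>
  reads \<open>0 < j\<close> here.
\<close>

inductive C_shelling :: "('a \<Rightarrow> 'a \<Rightarrow> bool) \<Rightarrow> 'a set \<Rightarrow> 'a list \<Rightarrow> bool"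
  for le :: "'a \<Rightarrow> 'a \<Rightarrow> bool" where
  low_rank:
    "\<lbrakk>finite_poset le P; has_least le P; pure le P;
      distinct xs; set xs = facets le P;
      poset_rank le P \<le> 1\<rbrakk>
     \<Longrightarrow> C_shelling le P xs"
| high_rank:
    "\<lbrakk>finite_poset le P; has_least le P; pure le P;
      distinct xs; set xs = facets le P;
      poset_rank le P \<ge> 2;
      \<forall>j<length xs. 0 < j \<longrightarrow>
        pure le (shelling_intersection le P xs j) \<and>
        poset_rank le (shelling_intersection le P xs j) = poset_rank le P - 1;
      \<forall>j<length xs.
        (\<exists>ys. C_shelling le (strictly_below le P (xs ! j)) ys) \<and>
        (0 < j \<longrightarrow>
          (\<exists>ys zs. C_shelling le (strictly_below le P (xs ! j)) (ys @ zs) \<and>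
                   set ys = facets le (shelling_intersection le P xs j)))\<rbrakk>
     \<Longrightarrow> C_shelling le P xs"

definition C_shellable :: "('a \<Rightarrow> 'a \<Rightarrow> bool) \<Rightarrow> 'a set \<Rightarrow> bool" where
  "C_shellable le P \<longleftrightarrow> pure le P \<and> (\<exists>xs. C_shelling le P xs)"


subsection \<open>Chain polynomials\<close>

definition chain_poly :: "('a \<Rightarrow> 'a \<Rightarrow> bool) \<Rightarrow> 'a set \<Rightarrow> real poly" where
  "chain_poly le Q = (\<Sum>C | pred_on.chain Q le C. monom 1 (card C))"

definition real_rooted :: "real poly \<Rightarrow> bool" where
  "real_rooted p \<longleftrightarrow> (\<forall>z::complex. poly (map_poly of_real p) z = 0 \<longrightarrow> z \<in> \<real>)"

end

theory Submission
  imports Defs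
begin

text \<open>
  The number of elements of each rank below an element of rank \<open>n\<close> depends only on \<open>n\<close>, so at a
  point \<open>z\<close> the chain polynomial of \<open>P\<^sub>S\<close> is \<open>1 + (\<Sum>x\<in>P. l (\<rho> x))\<close> for a weight \<open>l\<close> on ranks.
  A facet of rank \<open>d + 1\<close> attached in a C-shelling contributes new elements with rank generating
  function \<open>q * (\<Prod>i. q + r - a i)\<close>, where \<open>a i\<close> counts the coatoms in direction \<open>i\<close> among the
  facets of the intersection \<open>H\<close>.  Condition (S2) forces that some \<open>a i\<close> is \<open>1\<close> or that no \<open>a i\<close>
  vanishes.  The contribution is then a nonnegative combination of the weights \<open>B\<^sub>k\<close> of
  \<open>q * (q + r - 1) * q ^ k * (q + r) ^ (d - 1 - k)\<close> for \<open>k < d\<close> and \<open>B\<^sub>d\<close> of \<open>q ^ (d + 1)\<close>, while the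
  first facet contributes the chain polynomial \<open>A\<close> of a cube.  The sequences \<open>A, B\<^sub>0, \<dots>, B\<^sub>d\<close> obey a
  recursion in \<open>d\<close>, up to positive constants, of the type \<open>f' i = x * (\<Sum>j<i. f j) + (\<Sum>j\<ge>i. f j)\<close> with \<open>x = z / (1 + z)\<close>.  For
  \<open>Im z > 0\<close> it preserves the property that the arguments increase along the sequence within a
  sector of opening \<open>arg x < pi\<close>, so \<open>A\<close> plus a nonnegative combination of the \<open>B\<^sub>k\<close> cannot vanish.
\<close>

section \<open>Sequences in a sector\<close>

text \<open>\<open>sector x u v\<close> says that \<open>arg (v / u)\<close> lies between \<open>0\<close> and \<open>arg x\<close>, division-free so that
  it is linear in \<open>u\<close> and in \<open>v\<close> over the nonnegative reals.\<close>

definition sector :: "complex \<Rightarrow> complex \<Rightarrow> complex \<Rightarrow> bool" where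
  "sector x u v \<longleftrightarrow> Im (v * cnj u) \<ge> 0 \<and> Im (x * u * cnj v) \<ge> 0"

lemma sector_0: "sector x u 0" "sector x 0 v"
  by (simp_all add: sector_def)

lemma sector_refl:
  assumes "Im x \<ge> 0"
  shows "sector x u u"
proof -
  have "Im (x * u * cnj u) = Im x * (cmod u)\<^sup>2"
    unfolding mult.assoc complex_norm_square[symmetric] by (simp del: of_real_power)
  moreover have "Im (u * cnj u) = 0"
    unfolding complex_norm_square[symmetric] by (simp del: of_real_power)
  ultimately show ?thesis
    using assms by (simp add: sector_def)
qed

lemma sector_add_right: "sector x u v \<Longrightarrow> sector x u w \<Longrightarrow> sector x u (v + w)"
  unfolding sector_def by (simp add: algebra_simps)

lemma sector_add_left: "sector x u w \<Longrightarrow> sector x v w \<Longrightarrow> sector x (u + v) w"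
  unfolding sector_def by (simp add: algebra_simps)

lemma sector_scale_right:
  assumes "sector x u v" "c \<ge> 0"
  shows "sector x u (of_real c * v)"
proof -
  have "Im (of_real c * v * cnj u) = c * Im (v * cnj u)"
    "Im (x * u * cnj (of_real c * v)) = c * Im (x * u * cnj v)"
    by (simp_all add: algebra_simps)
  with assms show ?thesis
    unfolding sector_def by simp
qed

lemma sector_scale_left:
  assumes "sector x u v" "c \<ge> 0"
  shows "sector x (of_real c * u) v"
proof -
  have "Im (v * cnj (of_real c * u)) = c * Im (v * cnj u)"
    "Im (x * (of_real c * u) * cnj v) = c * Im (x * u * cnj v)"
    by (simp_all add: algebra_simps)
  with assms show ?thesis
    unfolding sector_def by simp
qed

lemma sector_sum_right:
  assumes "\<And>j. j \<in> J \<Longrightarrow> sector x u (f j)"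
  shows "sector x u (\<Sum>j\<in>J. f j)"
  using assms by (induction J rule: infinite_finite_induct) (auto simp: sector_0 sector_add_right)

lemma sector_sum_left:
  assumes "\<And>j. j \<in> J \<Longrightarrow> sector x (f j) v"
  shows "sector x (\<Sum>j\<in>J. f j) v"
  using assms by (induction J rule: infinite_finite_induct) (auto simp: sector_0 sector_add_left)

text \<open>A common factor turns both arguments by the same angle; both imaginary parts are
  multiplied by the squared modulus of \<open>c\<close>.\<close>

lemma sector_mult_common:
  assumes "sector x u v"
  shows "sector x (c * u) (c * v)"
proof -
  have "c * v * cnj (c * u) = of_real ((cmod c)\<^sup>2) * (v * cnj u)"
    "x * (c * u) * cnj (c * v) = of_real ((cmod c)\<^sup>2) * (x * u * cnj v)"
    unfolding complex_norm_square by (simp_all add: algebra_simps)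
  then have "Im (c * v * cnj (c * u)) = (cmod c)\<^sup>2 * Im (v * cnj u)"
    "Im (x * (c * u) * cnj (c * v)) = (cmod c)\<^sup>2 * Im (x * u * cnj v)"
    by (simp_all only: times_complex.sel Re_complex_of_real Im_complex_of_real mult_zero_left add_0_right)
  with assms show ?thesis
    unfolding sector_def by simp
qed

text \<open>Cancellation would force \<open>v = - u\<close>, a rotation by pi, while the sector has
  opening \<open>arg x < pi\<close>; concretely, \<open>Im (x * u * cnj v)\<close> would be
  negative.\<close>

lemma sector_add_nonzero:
  assumes "Im x > 0" "u \<noteq> 0" "sector x u v"
  shows "u + v \<noteq> 0"
proof
  assume "u + v = 0"
  then have "v = - u"
    by (simp add: eq_neg_iff_add_eq_0 add.commute)
  then have "x * u * cnj v = - (of_real ((cmod u)\<^sup>2) * x)"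
    unfolding complex_norm_square by (simp add: algebra_simps)
  then have "Im (x * u * cnj v) = - ((cmod u)\<^sup>2 * Im x)"
    by (simp del: of_real_power)
  moreover have "(cmod u)\<^sup>2 * Im x > 0"
    using assms by simp
  ultimately show False
    using assms(3) unfolding sector_def by linarith
qed

text \<open>\<open>V\<close>, \<open>U\<close> and \<open>T\<close> play the sums of a sequence
  before \<open>i\<close>, from \<open>i\<close> to \<open>j\<close>, and from \<open>j\<close> on;
  the two combinations are then the new members \<open>i\<close> and \<open>j\<close> of the
  recursion. Both imaginary parts expand into nonnegative multiples of quantities that the
  assumptions bound, plus \<open>Im x\<close> times a squared modulus.\<close>

lemma sector_step:
  assumes "Im x \<ge> 0" "sector x V U" "sector x V T" "sector x U T"
  shows "sector x (x * V + U + T) (x * V + x * U + T)"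
proof -
  have "Im ((x * V + x * U + T) * cnj (x * V + U + T)) =
      Im (x * V * cnj U) + Im (T * cnj U) + (cmod x)\<^sup>2 * Im (U * cnj V) + Im (x * U * cnj T)
      + Im x * (cmod U)\<^sup>2"
    unfolding cmod_power2 by (simp add: algebra_simps power2_eq_square)
  moreover have "Im (x * (x * V + U + T) * cnj (x * V + x * U + T)) =
      Im x * (cmod (x * V + T))\<^sup>2 + (cmod x)\<^sup>2 * Im (U * cnj V) + Im (x * U * cnj T)
      + (cmod x)\<^sup>2 * (Im (x * V * cnj U) + Im (T * cnj U))"
    unfolding cmod_power2 by (simp add: algebra_simps power2_eq_square)
  ultimately show ?thesis
    using assms unfolding sector_def by (auto intro!: add_nonneg_nonneg mult_nonneg_nonneg)
qed

section \<open>Weights of rank generating functions\<close>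

text \<open>The linear functional that sends \<open>q ^ k\<close> to \<open>l k\<close>. Applied to
  a rank generating function it gives the total weight of the elements counted.\<close>

definition evalw :: "(nat \<Rightarrow> complex) \<Rightarrow> complex poly \<Rightarrow> complex" where
  "evalw l p = (\<Sum>k\<le>degree p. coeff p k * l k)"

lemma evalw_eq:
  assumes "degree p \<le> n"
  shows "evalw l p = (\<Sum>k\<le>n. coeff p k * l k)"
  unfolding evalw_def using assms
  by (intro sum.mono_neutral_left) (auto simp: coeff_eq_0)

lemma evalw_0 [simp]: "evalw l 0 = 0"
  by (simp add: evalw_def)

lemma evalw_add: "evalw l (p + p') = evalw l p + evalw l p'"
proof -
  define n where "n = max (degree p) (degree p')"
  have "degree (p + p') \<le> n" "degree p \<le> n" "degree p' \<le> n"
    by (auto simp: n_def degree_add_le_max)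
  then show ?thesis
    by (simp add: evalw_eq algebra_simps sum.distrib)
qed

lemma evalw_smult: "evalw l (smult c p) = c * evalw l p"
  using evalw_eq[of "smult c p" "degree p" l]
  by (simp add: evalw_def degree_smult_le sum_distrib_left mult.assoc)

lemma evalw_sum: "evalw l (\<Sum>i\<in>I. f i) = (\<Sum>i\<in>I. evalw l (f i))"
  by (induction I rule: infinite_finite_induct) (auto simp: evalw_add)

lemma evalw_monom: "evalw l (monom c k) = c * l k"
proof -
  have "evalw l (monom c k) = (\<Sum>i\<le>k. coeff (monom c k) i * l i)"
    by (rule evalw_eq) (rule degree_monom_le)
  also have "\<dots> = (\<Sum>i\<in>{k}. coeff (monom c k) i * l i)"
    by (rule sum.mono_neutral_right) auto
  finally show ?thesis by simp
qed

lemma evalw_one_fun: "evalw (\<lambda>_. 1) p = poly p 1"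
  by (simp add: evalw_def poly_altdef)

definition lin :: "complex \<Rightarrow> complex poly" where
  "lin b = [:b, 1:]"

abbreviation q :: "complex poly" where
  "q \<equiv> lin 0"

lemma q_power: "q ^ k = monom 1 k"
  by (simp add: monom_altdef lin_def)

lemma evalw_q_power: "evalw l (q ^ k) = l k"
  by (simp add: q_power evalw_monom)

text \<open>Expanding one factor \<open>lin b\<close> as \<open>q + b\<close>. Comparing two values
  of \<open>b\<close> expresses one product through others in which this factor is replaced or
  dropped.\<close>

lemma evalw_lin_split:
  "evalw l (p * lin b * p') = evalw l (p * q * p') + b * evalw l (p * p')"
proof -
  have "lin b = q + [:b:]" by (simp add: lin_def)
  then have "p * lin b * p' = p * q * p' + smult b (p * p')"
    by (simp only: algebra_simps) simp
  then show ?thesis by (simp only: evalw_add evalw_smult)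
qed

section \<open>Cube polynomials and rank weights\<close>

text \<open>The rank generating function of an \<open>r\<close>-cube of rank \<open>n\<close>: the
  summand \<open>1\<close> is the least element, the factor \<open>q\<close> is the shift in
  \<open>cub_rank\<close>, and each free coordinate is either \<open>Z\<close>, counted by
  \<open>q\<close>, or one of \<open>r\<close> atoms.\<close>

definition cube_poly :: "nat \<Rightarrow> nat \<Rightarrow> complex poly" where
  "cube_poly r n = (if n = 0 then 1 else 1 + q * lin (of_nat r) ^ (n - 1))"

text \<open>The weight of an element of rank \<open>n\<close>: the sum of \<open>z ^ card C\<close> over the chains \<open>C\<close> of \<open>P\<^sub>S\<close>
  whose top is that element.\<close>

function rank_weight :: "nat \<Rightarrow> complex \<Rightarrow> nat set \<Rightarrow> nat \<Rightarrow> complex" where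
  "rank_weight r z S n = (if n \<in> S then z * (1 + (\<Sum>k<n. coeff (cube_poly r n) k * rank_weight r z S k)) else 0)"
  by pat_completeness auto
termination by (relation "measure (\<lambda>(r, z, S, n). n)") auto

declare rank_weight.simps [simp del]

lemma cube_poly_top: "degree (cube_poly r n) \<le> n" "coeff (cube_poly r n) n = 1"
proof -
  let ?b = "of_nat r :: complex"
  show "coeff (cube_poly r n) n = 1"
  proof (cases n)
    case (Suc m)
    have "coeff (lin ?b ^ m) m = 1"
      using lead_coeff_power[of "lin ?b" m] by (simp add: degree_power_eq lin_def)
    then show ?thesis
      by (simp add: cube_poly_def Suc lin_def[of 0])
  qed (simp add: cube_poly_def)
  have "degree (q * lin ?b ^ m) \<le> Suc m" for m
    using degree_mult_le[of q "lin ?b ^ m"] by (simp add: degree_power_eq lin_def)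
  then show "degree (cube_poly r n) \<le> n"
    by (cases n) (auto simp: cube_poly_def intro!: degree_add_le)
qed

text \<open>The sum over the ranks below \<open>n\<close> is completed to the full cube polynomial,
  whose top coefficient is 1; this is why the weight of rank \<open>n\<close> is subtracted
  again.\<close>

lemma rank_weight_eq:
  "rank_weight r z S n = (if n \<in> S then z * (1 + evalw (rank_weight r z S) (cube_poly r n) - rank_weight r z S n) else 0)"
proof -
  have "evalw (rank_weight r z S) (cube_poly r n) = (\<Sum>k\<le>n. coeff (cube_poly r n) k * rank_weight r z S k)"
    by (rule evalw_eq) (rule cube_poly_top)
  also have "\<dots> = (\<Sum>k<n. coeff (cube_poly r n) k * rank_weight r z S k) + rank_weight r z S n"
    using cube_poly_top(2)[of r n] by (simp flip: lessThan_Suc_atMost)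
  finally show ?thesis
    by (subst rank_weight.simps) simp
qed

text \<open>The sequence \<open>A, B\<^sub>0, \<dots>, B\<^sub>d\<close>; the summand \<open>1 + l 0\<close> of \<open>A\<close> accounts for the empty chain and
  for the least element.\<close>

definition piece :: "(nat \<Rightarrow> complex) \<Rightarrow> nat \<Rightarrow> nat \<Rightarrow> nat \<Rightarrow> complex" where
  "piece l r d i =
     (if i = 0 then 1 + l 0 + evalw l (q * lin (of_nat r) ^ d)
      else if i \<le> d then evalw l (q * lin (of_nat r - 1) * q ^ (i - 1) * lin (of_nat r) ^ (d - i))
      else evalw l (q ^ Suc d))"

text \<open>The constants of the recursion in \<open>d\<close>. They are nonnegative for
  \<open>r > 0\<close>, but the last one vanishes for \<open>r = 1\<close>.\<close>

definition piece_coeff :: "nat \<Rightarrow> nat \<Rightarrow> nat \<Rightarrow> real" where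
  "piece_coeff r d j = (if j = 0 then 1 else if j \<le> d then real r else real r - 1)"

text \<open>Neighbouring members differ in one linear factor: \<open>q + r\<close> against
  \<open>q + r - 1\<close>, \<open>q + r\<close> against \<open>q\<close>, or
  \<open>q + r - 1\<close> against \<open>q\<close>. The difference of these factors is a constant,
  which leaves a product of the previous dimension.\<close>

lemma piece_diff:
  assumes "i \<le> Suc d"
  shows "piece l r (Suc d) i - piece l r (Suc d) (Suc i) = of_real (piece_coeff r d i) * piece l r d i"
proof -
  let ?b = "of_nat r :: complex"
  consider "i = 0" | "0 < i" "i \<le> d" | "i = Suc d"
    using assms by linarith
  then show ?thesis
  proof cases
    case 1
    have "evalw l (q * lin ?b * lin ?b ^ d) = evalw l (q * q * lin ?b ^ d) + ?b * evalw l (q * lin ?b ^ d)"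
      "evalw l (q * lin (?b - 1) * lin ?b ^ d)
        = evalw l (q * q * lin ?b ^ d) + (?b - 1) * evalw l (q * lin ?b ^ d)"
      by (rule evalw_lin_split)+
    with 1 show ?thesis
      by (simp add: piece_def piece_coeff_def algebra_simps)
  next
    case 2
    let ?p = "q * lin (?b - 1) * q ^ (i - 1)"
    have "evalw l (?p * lin ?b * lin ?b ^ (d - i))
      = evalw l (?p * q * lin ?b ^ (d - i)) + ?b * evalw l (?p * lin ?b ^ (d - i))"
      by (rule evalw_lin_split)
    moreover have "?p * lin ?b * lin ?b ^ (d - i) = ?p * lin ?b ^ (Suc d - i)"
      using 2 by (simp only: Suc_diff_le power_Suc mult.assoc)
    moreover have "?p * q = q * lin (?b - 1) * q ^ i"
      using 2 by (simp only: power_eq_if[of _ i] mult_ac) simp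
    ultimately show ?thesis
      using 2 by (simp only: piece_def piece_coeff_def) simp
  next
    case 3
    have "evalw l (q * lin (?b - 1) * q ^ d) = evalw l (q * q * q ^ d) + (?b - 1) * evalw l (q * q ^ d)"
      by (rule evalw_lin_split)
    with 3 show ?thesis
      by (simp add: piece_def piece_coeff_def mult.assoc)
  qed
qed

text \<open>Telescoping \<open>piece_diff\<close> makes every member the last one plus a tail sum of
  the scaled sequence of the previous dimension.\<close>

lemma piece_Suc:
  assumes "i \<le> Suc (Suc d)"
  shows "piece l r (Suc d) i
    = piece l r (Suc d) (Suc (Suc d)) + (\<Sum>j\<in>{i..<Suc (Suc d)}. of_real (piece_coeff r d j) * piece l r d j)"
proof -
  have "(\<Sum>j\<in>{i..<Suc (Suc d)}. of_real (piece_coeff r d j) * piece l r d j)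
    = (\<Sum>j\<in>{i..<Suc (Suc d)}. piece l r (Suc d) j - piece l r (Suc d) (Suc j))"
    by (rule sum.cong) (auto simp: piece_diff)
  also have "\<dots> = piece l r (Suc d) i - piece l r (Suc d) (Suc (Suc d))"
    using sum_Suc_diff'[of i "Suc (Suc d)" "\<lambda>j. - piece l r (Suc d) j"] assms
    by (simp add: algebra_simps)
  finally show ?thesis by simp
qed

text \<open>\<open>piece l r d 0\<close> is the chain sum of a rank-selected cube of rank
  \<open>d + 1\<close>, and the last piece is the weight of its top. If the top is selected, this
  weight is \<open>z\<close> times the chain sum of the cube without its top.\<close>

lemma piece_last:
  fixes r S z
  defines "l \<equiv> rank_weight r z S"
  shows "piece l r d (Suc d) = (if Suc d \<in> S then z * (piece l r d 0 - piece l r d (Suc d)) else 0)"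
proof -
  have 1: "piece l r d (Suc d) = l (Suc d)"
    by (simp add: piece_def evalw_q_power del: power_Suc)
  have "evalw l 1 = l 0"
    using evalw_q_power[of l 0] by simp
  then have 2: "1 + evalw l (cube_poly r (Suc d)) = piece l r d 0"
    by (simp add: cube_poly_def evalw_add piece_def)
  show ?thesis
    unfolding 1 2[symmetric] unfolding l_def by (subst rank_weight_eq) simp
qed

section \<open>The sector property of the pieces\<close>

lemma Im_divide_one_plus: "Im z > 0 \<Longrightarrow> Im (z / (1 + z)) > 0"
proof -
  assume z: "Im z > 0"
  then have "Im (z / (1 + z)) = Im z / ((1 + Re z)\<^sup>2 + (Im z)\<^sup>2)"
    by (simp add: Im_divide algebra_simps)
  with z show ?thesis
    by (simp add: add_nonneg_pos)
qed

text \<open>If the top rank is selected, dividing by \<open>1 + z\<close> brings both terms to the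
  form of \<open>sector_step\<close> with \<open>x = z / (1 + z)\<close>; otherwise only
  \<open>U + T\<close> and \<open>T\<close> remain.\<close>

lemma sector_recursion:
  fixes z and b :: bool
  defines "x \<equiv> z / (1 + z)"
  assumes z: "Im z > 0" and s: "sector x V U" "sector x V T" "sector x U T"
  defines "E \<equiv> (if b then z * (V + U + T) else 0)"
  shows "sector x (E + (U + T)) (E + T)"
proof (cases b)
  case True
  have "1 + z \<noteq> 0"
    using z by (auto simp: complex_eq_iff)
  then have "E + (U + T) = (1 + z) * (x * V + U + T)" "E + T = (1 + z) * (x * V + x * U + T)"
    using True by (simp_all add: E_def x_def distrib_left) (simp_all add: algebra_simps)
  then show ?thesis
    using sector_mult_common[OF sector_step[OF _ s]] Im_divide_one_plus[OF z] by (simp add: x_def)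
next
  case False
  then show ?thesis
    using s(3) Im_divide_one_plus[OF z]
    by (auto simp: E_def x_def intro!: sector_add_left sector_refl)
qed

text \<open>Induction on \<open>d\<close> through \<open>piece_Suc\<close> and
  \<open>piece_last\<close>, which rebuild the sequence from the scaled one of the previous
  dimension. Nonvanishing of the first member is carried along because it keeps the sum of the
  pieces of the previous dimension away from zero.\<close>

lemma piece_sector:
  fixes r S z
  defines "l \<equiv> rank_weight r z S" and "x \<equiv> z / (1 + z)"
  assumes r: "r > 0" and z: "Im z > 0"
  shows "piece l r d 0 \<noteq> 0 \<and>
    (\<forall>i j. i < j \<longrightarrow> j \<le> Suc d \<longrightarrow> sector x (piece l r d i) (piece l r d j))"
proof (induction d)
  case 0
  define a where "a = 1 + l 0"
  have nz: "1 + z \<noteq> 0"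
    using z by (auto simp: complex_eq_iff)
  have "l 0 = (if 0 \<in> S then z else 0)"
    by (simp add: l_def rank_weight.simps)
  with nz have a: "a \<noteq> 0"
    by (simp add: a_def)
  have 0: "piece l r 0 0 = a + piece l r 0 1"
    by (simp add: piece_def a_def)
  have 1: "piece l r 0 1 = (if 1 \<in> S then z * a else 0)"
  proof -
    have "piece l r 0 0 - piece l r 0 1 = a"
      unfolding 0 by (rule add_diff_cancel_right')
    then show ?thesis
      using piece_last[of r z S 0] by (simp only: l_def[symmetric] One_nat_def)
  qed
  have "piece l r 0 0 = (if 1 \<in> S then (1 + z) * a else a)"
    unfolding 0 1 by (simp add: algebra_simps)
  then have "piece l r 0 0 \<noteq> 0"
    using a nz by simp
  \<comment> \<open>The recursion started from the single term \<open>a\<close>, with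
    \<open>V\<close> and \<open>T\<close> equal to 0.\<close>
  moreover have "sector x (piece l r 0 0) (piece l r 0 1)"
    using sector_recursion[OF z, of 0 a 0 "1 \<in> S"] unfolding 0 1
    by (auto simp: sector_0 x_def add.commute)
  ultimately show ?case
    by (auto simp: less_Suc_eq_le le_Suc_eq)
next
  case (Suc d)
  define F where "F j = of_real (piece_coeff r d j) * piece l r d j" for j
  define s where "s i k = (\<Sum>j\<in>{i..<k}. F j)" for i k
  let ?n = "Suc (Suc d)"
  have piece_coeff: "piece_coeff r d j \<ge> 0" for j
    using r by (simp add: piece_coeff_def)
  have F: "sector x (F i) (F j)" if "i < j" "j \<le> Suc d" for i j
    using Suc that piece_coeff unfolding F_def by (auto intro!: sector_scale_left sector_scale_right)
  have s: "sector x (s i k) (s k' m)" if "k \<le> k'" "m \<le> ?n" for i k k' m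
    unfolding s_def using that by (auto intro!: sector_sum_left sector_sum_right F)
  have s_split: "s i m = s i k + s k m" if "i \<le> k" "k \<le> m" for i k m
    unfolding s_def using that by (simp add: sum.atLeastLessThan_concat)
  have piece: "piece l r (Suc d) i = piece l r (Suc d) ?n + s i ?n" if "i \<le> ?n" for i
    using piece_Suc[OF that] by (simp add: s_def F_def)
  have last: "piece l r (Suc d) ?n = (if ?n \<in> S then z * s 0 ?n else 0)"
  proof -
    have "piece l r (Suc d) 0 - piece l r (Suc d) ?n = s 0 ?n"
      using piece[of 0] by simp
    then show ?thesis
      using piece_last[of r z S "Suc d"] by (simp only: l_def[symmetric])
  qed
  \<comment> \<open>All later terms lie in the sector of \<open>F 0\<close>, which is nonzero
    because its coefficient is 1; hence the total does not vanish.\<close>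
  have "s 0 ?n = F 0 + s 1 ?n"
    using s_split[of 0 1 ?n] by (simp add: s_def)
  moreover have "F 0 \<noteq> 0" "sector x (F 0) (s 1 ?n)"
    using Suc s[of 1 1 ?n 0] by (auto simp: F_def piece_coeff_def s_def)
  ultimately have W: "s 0 ?n \<noteq> 0"
    using sector_add_nonzero Im_divide_one_plus[OF z] by (simp add: x_def)
  have nz: "1 + z \<noteq> 0"
    using z by (auto simp: complex_eq_iff)
  have "piece l r (Suc d) 0 = (if ?n \<in> S then (1 + z) * s 0 ?n else s 0 ?n)"
    using piece[of 0] last by (simp add: algebra_simps)
  with W nz have "piece l r (Suc d) 0 \<noteq> 0"
    by simp
  moreover have "sector x (piece l r (Suc d) i) (piece l r (Suc d) j)" if "i < j" "j \<le> ?n" for i j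
  proof -
    \<comment> \<open>The blocks before \<open>i\<close>, from \<open>i\<close> to \<open>j\<close>,
      and from \<open>j\<close> on serve as \<open>V\<close>, \<open>U\<close> and
      \<open>T\<close>.\<close>
    have "s 0 ?n = s 0 i + s i j + s j ?n" "s i ?n = s i j + s j ?n"
      using that s_split[of 0 i ?n] s_split[of i j ?n] by simp_all
    then have
      "piece l r (Suc d) i = (if ?n \<in> S then z * (s 0 i + s i j + s j ?n) else 0) + (s i j + s j ?n)"
      "piece l r (Suc d) j = (if ?n \<in> S then z * (s 0 i + s i j + s j ?n) else 0) + s j ?n"
      using piece[of i] piece[of j] last that by simp_all
    then show ?thesis
      using sector_recursion[OF z, of "s 0 i" "s i j" "s j ?n"] s that by (simp only: x_def)
  qed
  ultimately show ?case by blast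
qed

section \<open>Products of linear factors that arise from shellings\<close>

text \<open>Each factor \<open>q + b i\<close> is a convex combination of \<open>q\<close> and
  \<open>q + r\<close>. Resolving the factors one by one, with the exponents \<open>m\<close> and
  \<open>k\<close> as accumulators, ends in a nonnegative combination of the middle pieces.\<close>

lemma sector_mixed_product:
  fixes r S z
  defines "l \<equiv> rank_weight r z S" and "x \<equiv> z / (1 + z)"
  assumes r: "r > 0" and z: "Im z > 0" and I: "finite I"
    and b: "\<And>i. i \<in> I \<Longrightarrow> 0 \<le> b i \<and> b i \<le> real r"
    and d: "d = Suc (m + k + card I)"
  shows "sector x (piece l r d 0)
    (evalw l (q * lin (of_nat r - 1) * q ^ m * lin (of_nat r) ^ k * (\<Prod>i\<in>I. lin (of_real (b i)))))"
  using I b d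
proof (induction I arbitrary: m k rule: finite_induct)
  case empty
  have "piece l r d (Suc m) = evalw l (q * lin (of_nat r - 1) * q ^ m * lin (of_nat r) ^ k)"
    using empty by (simp add: piece_def)
  moreover have "Suc m \<le> Suc d"
    using empty by simp
  then have "sector x (piece l r d 0) (piece l r d (Suc m))"
    using piece_sector[OF r z, of S d] unfolding l_def x_def by blast
  ultimately show ?case
    by simp
next
  case (insert i I)
  let ?r = "of_nat r :: complex"
  let ?p = "q * lin (?r - 1) * q ^ m * lin ?r ^ k"
  let ?P = "\<Prod>i\<in>I. lin (of_real (b i))"
  define c where "c = b i / real r"
  have c: "0 \<le> c" "c \<le> 1"
    using insert.prems(1)[of i] r by (auto simp: c_def)
  have bc: "of_real (b i) = of_real c * ?r"
    using r by (simp add: c_def)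
  have 1: "evalw l (?p * lin (of_real (b i)) * ?P) = evalw l (?p * q * ?P) + of_real (b i) * evalw l (?p * ?P)"
    "evalw l (?p * lin ?r * ?P) = evalw l (?p * q * ?P) + ?r * evalw l (?p * ?P)"
    by (rule evalw_lin_split)+
  have "evalw l (?p * (\<Prod>i\<in>insert i I. lin (of_real (b i))))
    = evalw l (?p * lin (of_real (b i)) * ?P)"
    using insert.hyps by (simp add: mult.assoc)
  also have "\<dots> = of_real (1 - c) * evalw l (?p * q * ?P) + of_real c * evalw l (?p * lin ?r * ?P)"
    unfolding 1 unfolding bc by (simp add: algebra_simps)
  also have "?p * q = q * lin (?r - 1) * q ^ Suc m * lin ?r ^ k"
    by (simp only: power_Suc mult_ac)
  also have "?p * lin ?r = q * lin (?r - 1) * q ^ m * lin ?r ^ Suc k"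
    by (simp only: power_Suc mult_ac)
  finally show ?case
    using c insert.IH[of "Suc m" k] insert.IH[of m "Suc k"] insert.prems insert.hyps
    by (auto intro!: sector_add_right sector_scale_right simp del: power_Suc of_real_diff)
qed

text \<open>Now each factor is a convex combination of \<open>q\<close> and
  \<open>q + r - 1\<close>. A resolved product is either a power of \<open>q\<close>, which is the
  last piece, or contains a factor \<open>q + r - 1\<close> and falls under
  \<open>sector_mixed_product\<close>.\<close>

lemma sector_short_product:
  fixes r S z
  defines "l \<equiv> rank_weight r z S" and "x \<equiv> z / (1 + z)"
  assumes r: "r > 0" and z: "Im z > 0" and I: "finite I"
    and b: "\<And>i. i \<in> I \<Longrightarrow> 0 \<le> b i \<and> b i \<le> real r - 1"
    and d: "d = m + k + card I"
  shows "sector x (piece l r d 0)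
    (evalw l (q * q ^ m * lin (of_nat r - 1) ^ k * (\<Prod>i\<in>I. lin (of_real (b i)))))"
  using I b d
proof (induction I arbitrary: m k rule: finite_induct)
  case empty
  show ?case
  proof (cases k)
    case 0
    have "piece l r d (Suc d) = evalw l (q * q ^ m * lin (of_nat r - 1) ^ k)"
      using empty 0 by (simp add: piece_def)
    moreover have "sector x (piece l r d 0) (piece l r d (Suc d))"
      using piece_sector[OF r z, of S d] unfolding l_def x_def by blast
    ultimately show ?thesis
      using empty 0 by simp
  next
    case (Suc k')
    \<comment> \<open>One factor \<open>q + r - 1\<close> is set aside; the other \<open>k'\<close>
      become factors with constant \<open>r - 1\<close>, which lies between 0 and
      \<open>r\<close>.\<close>
    have eq: "q * q ^ m * lin (of_nat r - 1) ^ k =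
      q * lin (of_nat r - 1) * q ^ m * lin (of_nat r) ^ 0 * (\<Prod>i\<in>{..<k'}. lin (of_real (real r - 1)))"
      unfolding Suc by (simp only: power_Suc mult_ac prod_constant card_lessThan of_real_diff
        of_real_of_nat_eq of_real_1 power_0 mult_1)
    show ?thesis
      unfolding l_def x_def prod.empty mult_1_right eq
      using r z Suc empty by (intro sector_mixed_product) auto
  qed
next
  case (insert i I)
  let ?r = "of_nat r - 1 :: complex"
  let ?p = "q * q ^ m * lin ?r ^ k"
  let ?P = "\<Prod>i\<in>I. lin (of_real (b i))"
  define c where "c = b i / (real r - 1)"
  have c: "0 \<le> c" "c \<le> 1"
    using insert.prems(1)[of i] r by (auto simp: c_def divide_le_eq_1)
  \<comment> \<open>For \<open>r = 1\<close> the bounds force \<open>b i = 0\<close>, so the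
    identity survives the division by zero in \<open>c\<close>.\<close>
  have "b i = c * (real r - 1)"
    using insert.prems(1)[of i] r by (cases "r = 1") (auto simp: c_def)
  then have bc: "of_real (b i) = of_real c * ?r"
    by simp
  have 1: "evalw l (?p * lin (of_real (b i)) * ?P) = evalw l (?p * q * ?P) + of_real (b i) * evalw l (?p * ?P)"
    "evalw l (?p * lin ?r * ?P) = evalw l (?p * q * ?P) + ?r * evalw l (?p * ?P)"
    by (rule evalw_lin_split)+
  have "evalw l (?p * (\<Prod>i\<in>insert i I. lin (of_real (b i))))
    = evalw l (?p * lin (of_real (b i)) * ?P)"
    using insert.hyps by (simp add: mult.assoc)
  also have "\<dots> = of_real (1 - c) * evalw l (?p * q * ?P) + of_real c * evalw l (?p * lin ?r * ?P)"
    unfolding 1 unfolding bc by (simp add: algebra_simps)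
  also have "?p * q = q * q ^ Suc m * lin ?r ^ k"
    by (simp only: power_Suc mult_ac)
  also have "?p * lin ?r = q * q ^ m * lin ?r ^ Suc k"
    by (simp only: power_Suc mult_ac)
  finally show ?case
    using c insert.IH[of "Suc m" k] insert.IH[of m "Suc k"] insert.prems insert.hyps
    by (auto intro!: sector_add_right sector_scale_right simp del: power_Suc of_real_diff)
qed

text \<open>A direction with \<open>a i = 1\<close> provides the factor \<open>q + r - 1\<close> of
  the mixed product; if every \<open>a i\<close> is positive, all constants are at most
  \<open>r - 1\<close>.\<close>

lemma sector_shelling_piece:
  fixes r S z I
  defines "l \<equiv> rank_weight r z S" and "x \<equiv> z / (1 + z)" and "d \<equiv> card I"
  assumes r: "r > 0" and z: "Im z > 0" and I: "finite I"
    and a: "\<And>i. i \<in> I \<Longrightarrow> a i \<le> r"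
    and valid: "(\<exists>i\<in>I. a i = 1) \<or> (\<forall>i\<in>I. a i \<ge> 1)"
  shows "sector x (piece l r d 0) (evalw l (q * (\<Prod>i\<in>I. lin (of_nat (r - a i)))))"
  using valid
proof
  assume "\<exists>i\<in>I. a i = 1"
  then obtain i where i: "i \<in> I" "a i = 1" by blast
  have "sector x (piece l r d 0)
    (evalw l (q * lin (of_nat r - 1) * q ^ 0 * lin (of_nat r) ^ 0 *
      (\<Prod>i\<in>I - {i}. lin (of_real (real (r - a i))))))"
    unfolding l_def x_def using r z I i(1) card_gt_0_iff[of I]
    by (intro sector_mixed_product) (auto simp: d_def)
  moreover have "of_nat (r - a i) = (of_nat r - 1 :: complex)"
    using i r by (simp add: of_nat_diff)
  ultimately show ?thesis
    using prod.remove[OF I i(1), of "\<lambda>i. lin (of_nat (r - a i))"]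
    by (simp only: power_0 mult.assoc mult_1 of_real_of_nat_eq)
next
  assume pos: "\<forall>i\<in>I. a i \<ge> 1"
  have "real (r - a i) \<le> real r - 1" if "i \<in> I" for i
    using a[OF that] pos that by (auto simp: of_nat_diff)
  then have "sector x (piece l r d 0)
    (evalw l (q * q ^ 0 * lin (of_nat r - 1) ^ 0 * (\<Prod>i\<in>I. lin (of_real (real (r - a i))))))"
    unfolding l_def x_def using r z I by (intro sector_short_product) (auto simp: d_def)
  then show ?thesis
    by (simp only: power_0 mult.assoc mult_1 of_real_of_nat_eq)
qed

section \<open>Chains in finite posets\<close>

lemma finite_poset_iff:
  "finite_poset le P \<longleftrightarrow> finite P \<and> (\<forall>x\<in>P. le x x) \<and>
    (\<forall>x\<in>P. \<forall>y\<in>P. \<forall>w\<in>P. le x y \<longrightarrow> le y w \<longrightarrow> le x w) \<and>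
    (\<forall>x\<in>P. \<forall>y\<in>P. le x y \<longrightarrow> le y x \<longrightarrow> x = y)"
proof -
  let ?r = "relation_of le P"
  have "?r \<subseteq> P \<times> P" "refl_on P ?r \<longleftrightarrow> (\<forall>x\<in>P. le x x)"
    "trans ?r \<longleftrightarrow> (\<forall>x\<in>P. \<forall>y\<in>P. \<forall>w\<in>P. le x y \<longrightarrow> le y w \<longrightarrow> le x w)"
    "antisym ?r \<longleftrightarrow> (\<forall>x\<in>P. \<forall>y\<in>P. le x y \<longrightarrow> le y x \<longrightarrow> x = y)"
    unfolding refl_on_def trans_def antisym_def relation_of_def by (simp_all, blast+)
  then show ?thesis
    unfolding finite_poset_def partial_order_on_def preorder_on_def by simp
qed

lemma finite_posetD:
  assumes "finite_poset le P"
  shows "finite P"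
    and "\<And>x. x \<in> P \<Longrightarrow> le x x"
    and "\<And>x y w. \<lbrakk>x \<in> P; y \<in> P; w \<in> P; le x y; le y w\<rbrakk> \<Longrightarrow> le x w"
    and "\<And>x y. \<lbrakk>x \<in> P; y \<in> P; le x y; le y x\<rbrakk> \<Longrightarrow> x = y"
  using assms unfolding finite_poset_iff by (simp, blast, blast, blast)

lemma finite_poset_subset:
  assumes "finite_poset le P" "Q \<subseteq> P"
  shows "finite_poset le Q"
proof -
  have "finite Q"
    using finite_posetD(1)[OF assms(1)] assms(2) by (rule finite_subset[rotated])
  then show ?thesis
    using finite_posetD[OF assms(1)] assms(2) unfolding finite_poset_iff
    by (intro conjI ballI impI) blast+
qed

text \<open>Among the elements of \<open>A\<close> above \<open>a\<close>, one with the fewest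
  elements of \<open>A\<close> above it is maximal, since moving up strictly shrinks that
  set.\<close>

lemma finite_poset_maximal_above:
  assumes P: "finite_poset le P" and "A \<subseteq> P" "a \<in> A"
  shows "\<exists>m\<in>A. le a m \<and> (\<forall>y\<in>A. le m y \<longrightarrow> y = m)"
proof -
  note D = finite_posetD[OF P]
  have fin: "finite {y \<in> A. le x y}" for x
    using D(1) \<open>A \<subseteq> P\<close> by (auto intro: finite_subset)
  have a: "a \<in> A \<and> le a a"
    using assms D(2) by blast
  obtain m where m: "m \<in> A" "le a m"
    and least: "\<And>y. y \<in> A \<Longrightarrow> le a y \<Longrightarrow> card {w \<in> A. le m w} \<le> card {w \<in> A. le y w}"
    using ex_has_least_nat[of "\<lambda>m. m \<in> A \<and> le a m" a "\<lambda>m. card {w \<in> A. le m w}", OF a] by auto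
  have "y = m" if y: "y \<in> A" "le m y" for y
  proof (rule ccontr)
    assume "y \<noteq> m"
    have P': "m \<in> P" "y \<in> P" "a \<in> P"
      using m y assms by auto
    have "{w \<in> A. le y w} \<subset> {w \<in> A. le m w}"
    proof
      show "{w \<in> A. le y w} \<subseteq> {w \<in> A. le m w}"
        using D(3) P' y \<open>A \<subseteq> P\<close> by blast
      have "m \<notin> {w \<in> A. le y w}"
        using D(4) P' y \<open>y \<noteq> m\<close> by blast
      then show "{w \<in> A. le y w} \<noteq> {w \<in> A. le m w}"
        using m D(2) P' by blast
    qed
    then have "card {w \<in> A. le y w} < card {w \<in> A. le m w}"
      using psubset_card_mono fin by blast
    moreover have "le a y"
      using D(3) P' m y by blast
    ultimately show False
      using least y by fastforce
  qed
  with m show ?thesis by blast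
qed

lemma chain_iff:
  "pred_on.chain Q le C \<longleftrightarrow> C \<subseteq> Q \<and> (\<forall>x\<in>C. \<forall>y\<in>C. x = y \<or> le x y \<or> le y x)"
  unfolding pred_on.chain_def by auto

section \<open>Chain sums and their recursion\<close>

definition chain_sum :: "('a \<Rightarrow> 'a \<Rightarrow> bool) \<Rightarrow> 'a set \<Rightarrow> complex \<Rightarrow> complex" where
  "chain_sum le Q z = (\<Sum>C | pred_on.chain Q le C. z ^ card C)"

lemma map_poly_of_real_sum:
  "map_poly complex_of_real (\<Sum>i\<in>I. f i) = (\<Sum>i\<in>I. map_poly complex_of_real (f i))"
  by (induction I rule: infinite_finite_induct)
     (simp_all add: poly_eq_iff coeff_map_poly)

lemma poly_chain_poly: "poly (map_poly of_real (chain_poly le Q)) z = chain_sum le Q z"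
  by (simp add: chain_poly_def chain_sum_def map_poly_of_real_sum poly_sum map_poly_monom poly_monom)

lemma chain_sum_cnj: "chain_sum le Q (cnj z) = cnj (chain_sum le Q z)"
  by (simp add: chain_sum_def)

text \<open>Nonempty chains are sorted by their largest element \<open>x\<close>: removing it leaves
  an arbitrary chain strictly below \<open>x\<close>, and the factor \<open>z\<close> records the
  removal.\<close>

lemma chain_sum_rec:
  assumes Q: "finite_poset le Q"
  shows "chain_sum le Q z = 1 + (\<Sum>x\<in>Q. z * chain_sum le (strictly_below le Q x) z)"
proof -
  note D = finite_posetD[OF Q]
  define ch where "ch R = {C. pred_on.chain R le C}" for R
  define B where "B x = insert x ` ch (strictly_below le Q x)" for x
  have fin: "finite (ch R)" if "R \<subseteq> Q" for R
    by (rule finite_subset[of _ "Pow Q"]) (use that D(1) in \<open>auto simp: ch_def chain_iff\<close>)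
  have sub: "strictly_below le Q x \<subseteq> Q" for x
    by (auto simp: strictly_below_def)
  have top: "x \<in> C \<and> C \<subseteq> Q \<and> (\<forall>y\<in>C. le y x)" if "x \<in> Q" "C \<in> B x" for x C
    using that D(2) by (auto simp: B_def ch_def chain_iff strictly_below_def)
  have "C \<in> {{}} \<union> (\<Union>x\<in>Q. B x)" if "C \<in> ch Q" for C
  proof (cases "C = {}")
    case False
    then obtain a where a: "a \<in> C" by blast
    have C: "C \<subseteq> Q" "\<And>x y. x \<in> C \<Longrightarrow> y \<in> C \<Longrightarrow> x = y \<or> le x y \<or> le y x"
      using that by (auto simp: ch_def chain_iff)
    obtain m where m: "m \<in> C" "le a m" "\<And>y. y \<in> C \<Longrightarrow> le m y \<Longrightarrow> y = m"
      using finite_poset_maximal_above[OF Q C(1) a] by blast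
    have "C - {m} \<subseteq> strictly_below le Q m"
    proof
      fix y assume "y \<in> C - {m}"
      then show "y \<in> strictly_below le Q m"
        using C(1) C(2)[of y m] m(1) m(3)[of y] by (auto simp: strictly_below_def)
    qed
    moreover have "\<forall>x\<in>C - {m}. \<forall>y\<in>C - {m}. x = y \<or> le x y \<or> le y x"
      using C(2) by simp
    ultimately have "C - {m} \<in> ch (strictly_below le Q m)"
      unfolding ch_def chain_iff by simp
    moreover have "C = insert m (C - {m})"
      using m by blast
    ultimately have "C \<in> B m"
      unfolding B_def by blast
    then show ?thesis
      using m C by blast
  qed simp
  moreover have "C \<in> ch Q" if "C \<in> {{}} \<union> (\<Union>x\<in>Q. B x)" for C
    using that by (auto simp: B_def ch_def chain_iff strictly_below_def)
  ultimately have ch: "ch Q = {{}} \<union> (\<Union>x\<in>Q. B x)"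
    by blast
  have finB: "finite (B x)" for x
    unfolding B_def by (intro finite_imageI fin sub)
  have disj: "B x \<inter> B y = {}" if "x \<in> Q" "y \<in> Q" "x \<noteq> y" for x y
    using top[of x] top[of y] that D(4)[of x y] by blast
  have "(\<Sum>C\<in>B x. z ^ card C) = z * chain_sum le (strictly_below le Q x) z" if "x \<in> Q" for x
  proof -
    have "inj_on (insert x) (ch (strictly_below le Q x))"
      by (rule inj_onI) (auto simp: ch_def chain_iff strictly_below_def set_eq_iff)
    then have "(\<Sum>C\<in>B x. z ^ card C) = (\<Sum>C\<in>ch (strictly_below le Q x). z ^ card (insert x C))"
      unfolding B_def by (simp add: sum.reindex)
    also have "\<dots> = (\<Sum>C\<in>ch (strictly_below le Q x). z * z ^ card C)"
    proof (rule sum.cong)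
      fix C assume C: "C \<in> ch (strictly_below le Q x)"
      then have "x \<notin> C" "finite C"
        using D(1) by (auto simp: ch_def chain_iff strictly_below_def intro: finite_subset)
      then show "z ^ card (insert x C) = z * z ^ card C"
        by simp
    qed simp
    finally show ?thesis
      by (simp add: chain_sum_def ch_def sum_distrib_left)
  qed
  moreover have "{{}} \<inter> (\<Union>x\<in>Q. B x) = {}"
    by (auto simp: B_def)
  ultimately show ?thesis
    unfolding chain_sum_def ch_def[symmetric] ch using D(1) finB disj
    by (subst sum.union_disjoint) (auto simp: sum.UNION_disjoint chain_sum_def ch_def)
qed

section \<open>Cubes\<close>

lemma letter_le_trans: "letter_le a b \<Longrightarrow> letter_le b c \<Longrightarrow> letter_le a c"
  by (auto simp: letter_le_def)

lemma cub_le_refl: "cub_le x x"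
  by (cases x) (auto simp: letter_le_def)

lemma cub_le_trans: "cub_le x y \<Longrightarrow> cub_le y w \<Longrightarrow> cub_le x w"
  by (cases x; cases y; cases w) (simp_all, blast intro: letter_le_trans)

lemma cub_le_Bot: "cub_le x Bot \<longleftrightarrow> x = Bot"
  by (cases x) auto

text \<open>The free directions of \<open>\<xi>\<close> regarded as a face of the cube.\<close>

definition zset :: "(nat \<Rightarrow> letter) \<Rightarrow> nat set" where
  "zset \<xi> = {i. \<xi> i = Z}"

lemma zset_mono:
  assumes "\<forall>i. letter_le (\<eta> i) (\<xi> i)"
  shows "zset \<eta> \<subseteq> zset \<xi>"
proof
  fix i assume "i \<in> zset \<eta>"
  then show "i \<in> zset \<xi>"
    using assms[rule_format, of i] by (auto simp: zset_def letter_le_def)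
qed

lemma cub_rank_Seq: "cub_rank (Seq \<xi>) = Suc (card (zset \<xi>))"
  by (simp add: zset_def)

lemma C_inf_Bot: "Bot \<in> C_inf r"
  by (simp add: C_inf_def)

lemma C_inf_Seq: "Seq \<xi> \<in> C_inf r \<longleftrightarrow> (\<forall>i. \<xi> i \<in> M r) \<and> finite (zset \<xi>)"
proof -
  have "{i. \<xi> i \<notin> Atom ` {1..r}} = zset \<xi>" if "\<forall>i. \<xi> i \<in> M r"
    using that by (auto simp: M_def zset_def)
  then show ?thesis
    by (auto simp: C_inf_def)
qed

lemma Seq_le_Seq:
  assumes "Seq \<xi> \<in> C_inf r"
  shows "Seq \<eta> \<in> C_inf r \<and> cub_le (Seq \<eta>) (Seq \<xi>)
    \<longleftrightarrow> (\<forall>i. if i \<in> zset \<xi> then \<eta> i \<in> M r else \<eta> i = \<xi> i)"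
proof -
  have letter: "a \<in> M r \<and> letter_le a b \<longleftrightarrow> (if b = Z then a \<in> M r else a = b)" if "b \<in> M r" for a b
    using that by (auto simp: letter_le_def)
  have \<xi>: "\<xi> i \<in> M r" for i
    using assms by (simp add: C_inf_Seq)
  have "zset \<eta> \<subseteq> zset \<xi>" if "\<forall>i. letter_le (\<eta> i) (\<xi> i)"
    using that by (rule zset_mono)
  moreover have "finite (zset \<xi>)"
    using assms by (simp add: C_inf_Seq)
  ultimately have "Seq \<eta> \<in> C_inf r \<and> cub_le (Seq \<eta>) (Seq \<xi>)
      \<longleftrightarrow> (\<forall>i. \<eta> i \<in> M r \<and> letter_le (\<eta> i) (\<xi> i))"
    by (auto simp: C_inf_Seq intro: finite_subset)
  also have "\<dots> \<longleftrightarrow> (\<forall>i. if i \<in> zset \<xi> then \<eta> i \<in> M r else \<eta> i = \<xi> i)"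
    using letter[OF \<xi>] by (simp add: zset_def)
  finally show ?thesis .
qed

lemma cub_rank_less:
  assumes "x \<in> C_inf r" "cub_le y x" "y \<noteq> x"
  shows "cub_rank y < cub_rank x"
proof (cases y)
  case Bot
  with assms show ?thesis by (cases x) auto
next
  case (Seq \<eta>)
  with assms obtain \<xi> where x: "x = Seq \<xi>" by (cases x) auto
  with Seq assms have le: "\<And>i. letter_le (\<eta> i) (\<xi> i)" and ne: "\<eta> \<noteq> \<xi>"
    by auto
  from ne obtain i where "\<eta> i \<noteq> \<xi> i" by blast
  then have "i \<in> zset \<xi> - zset \<eta>"
    using le[of i] by (auto simp: zset_def letter_le_def)
  moreover have "zset \<eta> \<subseteq> zset \<xi>"
    using le by (simp add: zset_mono)
  ultimately have "zset \<eta> \<subset> zset \<xi>" by blast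
  moreover have "finite (zset \<xi>)"
    using assms x by (simp add: C_inf_Seq)
  ultimately show ?thesis
    unfolding x Seq cub_rank_Seq by (simp add: psubset_card_mono)
qed

text \<open>The letters at the free coordinates are chosen independently: \<open>Z\<close>
  contributes \<open>q\<close>, and each of the \<open>r - card (A i)\<close> permitted atoms
  contributes 1. The extra factor \<open>q\<close> is the shift in \<open>cub_rank\<close>.\<close>

lemma sum_cube_avoiding:
  assumes \<xi>: "Seq \<xi> \<in> C_inf r" and A: "\<And>i. i \<in> zset \<xi> \<Longrightarrow> A i \<subseteq> {1..r}"
  shows "(\<Sum>\<eta> | Seq \<eta> \<in> C_inf r \<and> cub_le (Seq \<eta>) (Seq \<xi>) \<and> (\<forall>i\<in>zset \<xi>. \<eta> i \<notin> Atom ` A i).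
      l (cub_rank (Seq \<eta>)))
    = evalw l (q * (\<Prod>i\<in>zset \<xi>. lin (of_nat (r - card (A i)))))"
proof -
  let ?I = "zset \<xi>"
  let ?E = "{\<eta>. Seq \<eta> \<in> C_inf r \<and> cub_le (Seq \<eta>) (Seq \<xi>) \<and> (\<forall>i\<in>?I. \<eta> i \<notin> Atom ` A i)}"
  let ?B = "\<lambda>i. M r - Atom ` A i"
  have fin: "finite ?I"
    using \<xi> by (simp add: C_inf_Seq)
  have fM: "finite (M r)"
    by (simp add: M_def)
  have mem: "\<eta> \<in> ?E \<longleftrightarrow> (\<forall>i. if i \<in> ?I then \<eta> i \<in> ?B i else \<eta> i = \<xi> i)" for \<eta>
  proof -
    have "\<eta> \<in> ?E \<longleftrightarrow> (\<forall>i. if i \<in> ?I then \<eta> i \<in> M r else \<eta> i = \<xi> i) \<and> (\<forall>i\<in>?I. \<eta> i \<notin> Atom ` A i)"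
      using Seq_le_Seq[OF \<xi>, of \<eta>] by blast
    then show ?thesis by (simp only: Diff_iff) meson
  qed
  \<comment> \<open>Functions in \<open>PiE\<close> are undefined outside the free coordinates, so
    the bijection fills in \<open>\<xi>\<close> there and its inverse restricts.\<close>
  have bij: "bij_betw (\<lambda>g i. if i \<in> ?I then g i else \<xi> i) (PiE ?I ?B) ?E"
  proof (rule bij_betw_byWitness[where f' = "\<lambda>\<eta>. restrict \<eta> ?I"])
    show "(\<lambda>g i. if i \<in> ?I then g i else \<xi> i) ` PiE ?I ?B \<subseteq> ?E"
    proof (rule image_subsetI)
      fix g assume g: "g \<in> PiE ?I ?B"
      show "(\<lambda>i. if i \<in> ?I then g i else \<xi> i) \<in> ?E"
        by (rule mem[THEN iffD2]) (use PiE_mem[OF g] in simp)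
    qed
    show "(\<lambda>\<eta>. restrict \<eta> ?I) ` ?E \<subseteq> PiE ?I ?B"
    proof (rule image_subsetI)
      fix \<eta> assume "\<eta> \<in> ?E"
      then have \<eta>: "\<forall>i. if i \<in> ?I then \<eta> i \<in> ?B i else \<eta> i = \<xi> i"
        by (rule mem[THEN iffD1])
      have "\<eta> i \<in> ?B i" if "i \<in> ?I" for i
        using \<eta>[rule_format, of i] that by (simp only: if_True)
      then show "restrict \<eta> ?I \<in> PiE ?I ?B"
        by (intro PiE_I) simp_all
    qed
    show "\<forall>\<eta>\<in>?E. (\<lambda>i. if i \<in> ?I then restrict \<eta> ?I i else \<xi> i) = \<eta>"
    proof
      fix \<eta> assume "\<eta> \<in> ?E"
      then have \<eta>: "\<forall>i. if i \<in> ?I then \<eta> i \<in> ?B i else \<eta> i = \<xi> i"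
        by (rule mem[THEN iffD1])
      have "\<eta> i = \<xi> i" if "i \<notin> ?I" for i
        using \<eta>[rule_format, of i] that by (simp only: if_False)
      then show "(\<lambda>i. if i \<in> ?I then restrict \<eta> ?I i else \<xi> i) = \<eta>"
        by (auto simp: fun_eq_iff)
    qed
    show "\<forall>g\<in>PiE ?I ?B. restrict (\<lambda>i. if i \<in> ?I then g i else \<xi> i) ?I = g"
    proof
      fix g assume g: "g \<in> PiE ?I ?B"
      show "restrict (\<lambda>i. if i \<in> ?I then g i else \<xi> i) ?I = g"
        by (rule ext) (use PiE_arb[OF g] in simp)
    qed
  qed
  have lin: "lin (of_nat (r - card (A i))) = (\<Sum>y\<in>?B i. if y = Z then q else 1)" if "i \<in> ?I" for i
  proof -
    have B: "?B i = insert Z (Atom ` ({1..r} - A i))"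
      by (auto simp: M_def)
    have inj: "inj_on Atom X" for X
      by (auto simp: inj_on_def)
    have "(\<Sum>y\<in>?B i. if y = Z then q else 1) = q + (\<Sum>y\<in>Atom ` ({1..r} - A i). if y = Z then q else 1)"
      unfolding B by (subst sum.insert) auto
    also have "\<dots> = q + (\<Sum>y\<in>Atom ` ({1..r} - A i). 1)"
      by (intro arg_cong2[where f = plus] sum.cong) auto
    also have "\<dots> = q + of_nat (card ({1..r} - A i))"
      by (simp add: card_image[OF inj])
    also have "card ({1..r} - A i) = r - card (A i)"
      using A[OF that] by (simp add: card_Diff_subset finite_subset[OF A[OF that]])
    finally show ?thesis
      by (simp add: lin_def of_nat_poly)
  qed
  have "evalw l (q * (\<Prod>i\<in>?I. lin (of_nat (r - card (A i)))))
    = evalw l (q * (\<Prod>i\<in>?I. \<Sum>y\<in>?B i. if y = Z then q else 1))"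
    by (simp only: prod.cong[OF refl lin])
  also have "(\<Prod>i\<in>?I. \<Sum>y\<in>?B i. if y = Z then q else 1)
    = (\<Sum>g\<in>PiE ?I ?B. \<Prod>i\<in>?I. if g i = Z then q else 1)"
    using fin fM by (subst prod_sum_PiE) auto
  also have "q * \<dots> = (\<Sum>g\<in>PiE ?I ?B. q ^ Suc (card {i \<in> ?I. g i = Z}))"
  proof -
    have "(\<Prod>i\<in>?I. if g i = Z then q else 1) = q ^ card {i \<in> ?I. g i = Z}" for g
      using fin by (simp add: prod.If_cases Int_def)
    then show ?thesis by (simp add: sum_distrib_left)
  qed
  also have "evalw l \<dots> = (\<Sum>g\<in>PiE ?I ?B. l (Suc (card {i \<in> ?I. g i = Z})))"
    by (simp add: evalw_sum evalw_q_power del: power_Suc)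
  also have "\<dots> = (\<Sum>g\<in>PiE ?I ?B. l (cub_rank (Seq (\<lambda>i. if i \<in> ?I then g i else \<xi> i))))"
  proof (rule sum.cong)
    fix g
    have "zset (\<lambda>i. if i \<in> ?I then g i else \<xi> i) = {i \<in> ?I. g i = Z}"
      by (auto simp: zset_def)
    then show "l (Suc (card {i \<in> ?I. g i = Z}))
      = l (cub_rank (Seq (\<lambda>i. if i \<in> ?I then g i else \<xi> i)))"
      by (simp only: cub_rank_Seq)
  qed simp
  also have "\<dots> = (\<Sum>\<eta>\<in>?E. l (cub_rank (Seq \<eta>)))"
    using sum.reindex_bij_betw[OF bij, of "\<lambda>\<eta>. l (cub_rank (Seq \<eta>))"] .
  finally show ?thesis by simp
qed

lemma sum_cube:
  assumes x: "x \<in> C_inf r"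
  shows "(\<Sum>y\<in>ideal_below cub_le (C_inf r) x. l (cub_rank y)) = evalw l (cube_poly r (cub_rank x))"
proof (cases x)
  case Bot
  then have "ideal_below cub_le (C_inf r) x = {Bot}"
    by (auto simp: ideal_below_def cub_le_Bot C_inf_Bot)
  with Bot show ?thesis
    using evalw_q_power[of l 0] by (simp add: cube_poly_def)
next
  case (Seq \<xi>)
  let ?E = "{\<eta>. Seq \<eta> \<in> C_inf r \<and> cub_le (Seq \<eta>) (Seq \<xi>)}"
  have \<xi>: "Seq \<xi> \<in> C_inf r"
    using x Seq by simp
  have eq: "ideal_below cub_le (C_inf r) x = insert Bot (Seq ` ?E)"
  proof (intro set_eqI)
    fix y
    show "y \<in> ideal_below cub_le (C_inf r) x \<longleftrightarrow> y \<in> insert Bot (Seq ` ?E)"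
      unfolding Seq ideal_below_def by (cases y) (auto simp: C_inf_Bot)
  qed
  have sum: "(\<Sum>\<eta>\<in>?E. l' (cub_rank (Seq \<eta>))) = evalw l' (q * lin (of_nat r) ^ card (zset \<xi>))" for l'
    using sum_cube_avoiding[OF \<xi>, of "\<lambda>_. {}" l'] by simp
  \<comment> \<open>Finiteness is read off from the sum formula: over an infinite set the constant 1
    would sum to 0 by convention, but the formula gives a power of \<open>1 + r\<close>.\<close>
  have "finite ?E"
  proof (rule ccontr)
    assume "infinite ?E"
    then have "(\<Sum>\<eta>\<in>?E. (1::complex)) = 0" by simp
    moreover have "(\<Sum>\<eta>\<in>?E. (1::complex)) = (1 + of_nat r) ^ card (zset \<xi>)"
      using sum[of "\<lambda>_. 1"] by (simp add: evalw_one_fun lin_def poly_power add.commute)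
    moreover have "(1 + of_nat r :: complex) \<noteq> 0"
      using of_nat_neq_0[of r, where 'a = complex] by simp
    ultimately show False by simp
  qed
  then have "(\<Sum>y\<in>insert Bot (Seq ` ?E). l (cub_rank y)) = l 0 + (\<Sum>\<eta>\<in>?E. l (cub_rank (Seq \<eta>)))"
    by (subst sum.insert) (auto simp: sum.reindex inj_on_def)
  also have "\<dots> = evalw l (1 + q * lin (of_nat r) ^ card (zset \<xi>))"
    unfolding sum using evalw_q_power[of l 0] by (simp add: evalw_add)
  finally show ?thesis
    unfolding eq by (simp add: Seq cub_rank_Seq cube_poly_def del: cub_rank.simps)
qed

lemma letter_le_antisym: "letter_le a b \<Longrightarrow> letter_le b a \<Longrightarrow> a = b"
  by (auto simp: letter_le_def)

lemma cub_le_antisym: "cub_le x y \<Longrightarrow> cub_le y x \<Longrightarrow> x = y"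
  by (cases x; cases y) (auto intro: letter_le_antisym)

text \<open>Constant weight 1 turns the weighted sum over the cube into its number of elements, the
  value of the cube polynomial at 1.\<close>

lemma is_cube_card:
  assumes "is_cube r n le Q"
  shows "card Q = (if n = 0 then 1 else 1 + Suc r ^ (n - 1))"
proof -
  obtain c f where c: "c \<in> C_inf r" "cub_rank c = n"
    and f: "bij_betw f Q (ideal_below cub_le (C_inf r) c)"
    using assms by (auto simp: is_cube_def order_isomorphic_def)
  have "(of_nat (card Q) :: complex) = poly (cube_poly r n) 1"
    using sum_cube[OF c(1), of "\<lambda>_. 1"] c(2) bij_betw_same_card[OF f] by (simp add: evalw_one_fun)
  also have "\<dots> = of_nat (if n = 0 then 1 else 1 + Suc r ^ (n - 1))"
    by (simp add: cube_poly_def lin_def poly_power add.commute)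
  finally show ?thesis
    by (simp only: of_nat_eq_iff)
qed

lemma is_cube_unique:
  assumes "r > 0" "is_cube r n le Q" "is_cube r m le Q"
  shows "n = m"
  using is_cube_card[OF assms(2)] is_cube_card[OF assms(3)] assms(1)
  by (cases n; cases m) (auto split: if_splits)

section \<open>Shellings\<close>

lemma C_inf_upd:
  assumes "Seq \<xi> \<in> C_inf r" "i \<in> zset \<xi>" "a \<in> {1..r}"
  shows "Seq (\<xi>(i := Atom a)) \<in> C_inf r" "cub_le (Seq (\<xi>(i := Atom a))) (Seq \<xi>)"
proof -
  have "Seq (\<xi>(i := Atom a)) \<in> C_inf r \<and> cub_le (Seq (\<xi>(i := Atom a))) (Seq \<xi>)"
    unfolding Seq_le_Seq[OF assms(1)] using assms by (simp add: C_inf_Seq M_def)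
  then show "Seq (\<xi>(i := Atom a)) \<in> C_inf r" "cub_le (Seq (\<xi>(i := Atom a))) (Seq \<xi>)"
    by blast+
qed

lemma zset_upd: "zset (\<xi>(i := Atom a)) = zset \<xi> - {i}"
  by (auto simp: zset_def)

lemma Seq_upd_inj:
  assumes "i \<in> zset \<xi>" "k \<in> zset \<xi>" "\<xi>(i := Atom a) = \<xi>(k := Atom b)"
  shows "i = k \<and> a = b"
  using fun_cong[OF assms(3), of i] assms(1,2) by (auto simp: zset_def split: if_splits)

lemma Seq_upd_le_upd:
  assumes "cub_le (Seq \<eta>) (Seq (\<xi>(i := Atom a)))"
  shows "\<eta> i = Atom a"
  using assms by (auto simp: letter_le_def dest: spec[of _ i])

lemma C_shelling_facets: "C_shelling le Q xs \<Longrightarrow> distinct xs \<and> set xs = facets le Q"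
  by (cases rule: C_shelling.cases) auto

lemma C_shelling_step:
  assumes "C_shelling le Q xs" "poset_rank le Q \<ge> 2" "0 < j" "j < length xs"
  obtains ys zs where "C_shelling le (strictly_below le Q (xs ! j)) (ys @ zs)"
    "set ys = facets le (shelling_intersection le Q xs j)"
  using assms(1)
proof (cases rule: C_shelling.cases)
  case low_rank
  then show ?thesis using assms(2) by simp
next
  case high_rank
  then show ?thesis using assms(3,4) that by blast
qed

lemma chain_card_le:
  assumes "finite Q" "pred_on.chain Q le C"
  shows "card C \<le> Suc (poset_rank le Q)"
proof -
  have "{card C |C. pred_on.chain Q le C} \<subseteq> {..card Q}"
    using assms(1) by (auto simp: chain_iff intro: card_mono)
  then have "card C \<le> Max {card C |C. pred_on.chain Q le C}"
    using assms(2) by (intro Max_ge) (auto intro: finite_subset)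
  then show ?thesis
    by (simp add: poset_rank_def)
qed

lemma shelling_intersection_iff:
  assumes "j \<le> length xs"
  shows "w \<in> shelling_intersection le Q xs j
    \<longleftrightarrow> w \<in> Q \<and> le w (xs ! j) \<and> (\<exists>y\<in>set (take j xs). le w y)"
  unfolding shelling_intersection_def ideal_below_def nth_image[OF assms, symmetric] by auto

text \<open>The coatoms of the cube below \<open>Seq \<xi>\<close> are the \<open>Seq (\<xi>(i := Atom a))\<close> with \<open>\<xi> i = Z\<close>; this
  set collects those in direction \<open>i\<close> that belong to \<open>Y\<close>.\<close>

definition chosen_atoms :: "nat \<Rightarrow> cub set \<Rightarrow> (nat \<Rightarrow> letter) \<Rightarrow> nat \<Rightarrow> nat set" where
  "chosen_atoms r Y \<xi> i = {a \<in> {1..r}. Seq (\<xi>(i := Atom a)) \<in> Y}"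

text \<open>The condition that (S2) imposes on an initial set of coatoms. With \<open>a i\<close>
  the number of chosen atoms in direction \<open>i\<close>, it is the hypothesis of
  \<open>sector_shelling_piece\<close>; without free directions it holds vacuously.\<close>

definition valid_prefix :: "nat \<Rightarrow> cub set \<Rightarrow> (nat \<Rightarrow> letter) \<Rightarrow> bool" where
  "valid_prefix r Y \<xi> \<longleftrightarrow>
     (\<exists>i\<in>zset \<xi>. card (chosen_atoms r Y \<xi> i) = 1) \<or> (\<forall>i\<in>zset \<xi>. chosen_atoms r Y \<xi> i \<noteq> {})"

lemma sum_disjointed:
  fixes g :: "'b \<Rightarrow> complex"
  assumes "\<And>j. j < (m :: nat) \<Longrightarrow> finite (A j)"
  shows "(\<Sum>w\<in>(\<Union>j<m. A j). g w) = (\<Sum>j<m. \<Sum>w\<in>A j - (\<Union>i<j. A i). g w)"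
  using assms
proof (induction m)
  case (Suc m)
  have "(\<Union>j<Suc m. A j) = (\<Union>j<m. A j) \<union> (A m - (\<Union>i<m. A i))"
    by (auto simp: less_Suc_eq)
  then have "(\<Sum>w\<in>(\<Union>j<Suc m. A j). g w)
    = (\<Sum>w\<in>(\<Union>j<m. A j). g w) + (\<Sum>w\<in>A m - (\<Union>i<m. A i). g w)"
    using Suc.prems by (simp only:) (subst sum.union_disjoint, auto)
  with Suc show ?case by simp
qed simp

section \<open>Cubical posets\<close>

locale cubical_poset =
  fixes r :: nat and le :: "'a \<Rightarrow> 'a \<Rightarrow> bool" and P :: "'a set"
  assumes r_pos: "r > 0" and cubical: "cubical r le P"
begin

abbreviation down :: "'a \<Rightarrow> 'a set" where
  "down x \<equiv> ideal_below le P x"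

abbreviation rk :: "'a \<Rightarrow> nat" where
  "rk x \<equiv> elem_rank r le P x"

lemma poset: "finite_poset le P"
  using cubical by (simp add: cubical_def)

lemmas finite_P = finite_posetD(1)[OF poset]
  and le_refl = finite_posetD(2)[OF poset]
  and le_trans = finite_posetD(3)[OF poset]
  and le_antisym = finite_posetD(4)[OF poset]

lemma down_iff: "y \<in> down x \<longleftrightarrow> y \<in> P \<and> le y x"
  by (simp add: ideal_below_def)

lemma down_mono:
  assumes "x \<in> P" "y \<in> down x"
  shows "down y \<subseteq> down x"
proof
  fix w assume "w \<in> down y"
  then show "w \<in> down x"
    using assms le_trans[of w y x] by (simp add: down_iff)
qed

lemma strictly_below_idem:
  assumes "A \<subseteq> P" "x \<in> P" "y \<in> strictly_below le A x"
  shows "strictly_below le (strictly_below le A x) y = strictly_below le A y"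
proof (intro equalityI subsetI)
  fix w assume "w \<in> strictly_below le A y"
  then have w: "w \<in> A" "w \<in> P" "le w y" "w \<noteq> y" and y: "y \<in> P" "le y x" "y \<noteq> x"
    using assms by (auto simp: strictly_below_def)
  then have "le w x"
    using assms le_trans[of w y x] by simp
  moreover have "w \<noteq> x"
    using w y le_antisym[of x y] assms by blast
  ultimately show "w \<in> strictly_below le (strictly_below le A x) y"
    using w by (simp add: strictly_below_def)
qed (simp add: strictly_below_def)

section \<open>Charts from principal ideals to cubes\<close>

text \<open>The cube is normalised to be the ideal below \<open>f x\<close>, so that the same map
  also serves for the elements below \<open>x\<close>.\<close>

definition chart :: "('a \<Rightarrow> cub) \<Rightarrow> 'a \<Rightarrow> bool" where
  "chart f x \<longleftrightarrow> x \<in> P \<and> f x \<in> C_inf r \<and>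
     bij_betw f (down x) (ideal_below cub_le (C_inf r) (f x)) \<and>
     (\<forall>y\<in>down x. \<forall>w\<in>down x. le y w \<longleftrightarrow> cub_le (f y) (f w))"

text \<open>An order isomorphism matches greatest elements, so the top of the cube supplied by
  \<open>is_cube\<close> is \<open>f x\<close>.\<close>

lemma chart_exists:
  assumes x: "x \<in> P"
  obtains f where "chart f x"
proof -
  obtain n where "is_cube r n le (down x)"
    using cubical x by (auto simp: cubical_def)
  then obtain c f where c: "c \<in> C_inf r" and f: "bij_betw f (down x) (ideal_below cub_le (C_inf r) c)"
    and ord: "\<forall>y\<in>down x. \<forall>w\<in>down x. le y w \<longleftrightarrow> cub_le (f y) (f w)"
    by (auto simp: is_cube_def order_isomorphic_def)
  have x': "x \<in> down x"
    using x le_refl by (simp add: down_iff)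
  have "c \<in> f ` down x"
    using f c by (auto simp: bij_betw_def ideal_below_def cub_le_refl)
  then obtain y where y: "y \<in> down x" "f y = c" by blast
  then have "cub_le c (f x)"
    using ord[rule_format, OF y(1) x'] by (simp add: down_iff)
  moreover have "cub_le (f x) c"
    using bij_betw_apply[OF f x'] by (simp add: ideal_below_def)
  ultimately have "f x = c"
    by (blast intro: cub_le_antisym)
  with c f ord x have "chart f x"
    unfolding chart_def by simp
  then show ?thesis
    by (rule that)
qed

lemma chart_rank:
  assumes "chart f x"
  shows "rk x = cub_rank (f x)"
proof -
  have "is_cube r (cub_rank (f x)) le (down x)"
    using assms unfolding is_cube_def order_isomorphic_def chart_def by blast
  then show ?thesis
    unfolding elem_rank_def using is_cube_unique[OF r_pos] by blast
qed

lemma chart_mem: "chart f x \<Longrightarrow> y \<in> down x \<Longrightarrow> f y \<in> C_inf r \<and> cub_le (f y) (f x)"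
  using bij_betw_apply[of f "down x"] by (fastforce simp: chart_def ideal_below_def)

lemma chart_le: "chart f x \<Longrightarrow> y \<in> down x \<Longrightarrow> w \<in> down x \<Longrightarrow> le y w \<longleftrightarrow> cub_le (f y) (f w)"
  by (simp add: chart_def)

lemma chart_inj: "chart f x \<Longrightarrow> y \<in> down x \<Longrightarrow> w \<in> down x \<Longrightarrow> f y = f w \<longleftrightarrow> y = w"
  by (auto simp: chart_def bij_betw_def inj_on_def)

lemma chart_surj:
  assumes "chart f x" "c \<in> C_inf r" "cub_le c (f x)"
  obtains y where "y \<in> down x" "f y = c"
proof -
  have "c \<in> f ` down x"
    using assms by (auto simp: chart_def bij_betw_def ideal_below_def)
  with that show ?thesis by blast
qed

text \<open>One chart gives coordinates to all faces of \<open>x\<close> at once: elements of the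
  cube below \<open>f y\<close> already have preimages below \<open>x\<close>, and comparing orders
  places these below \<open>y\<close>.\<close>

lemma chart_below:
  assumes f: "chart f x" and y: "y \<in> down x"
  shows "chart f y"
proof -
  have x: "x \<in> P"
    using f by (simp add: chart_def)
  have sub: "down y \<subseteq> down x"
    by (rule down_mono[OF x y])
  have y': "y \<in> P" "y \<in> down y"
    using y le_refl by (auto simp: down_iff)
  have "f ` down y = ideal_below cub_le (C_inf r) (f y)"
  proof (intro equalityI subsetI)
    fix c assume "c \<in> f ` down y"
    then obtain w where w: "w \<in> down y" "c = f w" by blast
    then show "c \<in> ideal_below cub_le (C_inf r) (f y)"
      using chart_mem[OF f, of w] chart_le[OF f, of w y] sub y by (auto simp: ideal_below_def)
  next
    fix c assume "c \<in> ideal_below cub_le (C_inf r) (f y)"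
    then have c: "c \<in> C_inf r" "cub_le c (f y)"
      by (auto simp: ideal_below_def)
    then have "cub_le c (f x)"
      using chart_mem[OF f y] cub_le_trans by blast
    then obtain w where w: "w \<in> down x" "f w = c"
      using chart_surj[OF f c(1)] by metis
    then have "w \<in> down y"
      using chart_le[OF f w(1) y] c by (simp add: down_iff)
    with w show "c \<in> f ` down y" by blast
  qed
  moreover have "inj_on f (down y)"
    using f sub by (auto simp: chart_def bij_betw_def intro: inj_on_subset)
  moreover have "\<forall>u\<in>down y. \<forall>w\<in>down y. le u w \<longleftrightarrow> cub_le (f u) (f w)"
    using chart_le[OF f] sub by blast
  ultimately show ?thesis
    using y'(1) chart_mem[OF f y] by (simp add: chart_def bij_betw_def)
qed

lemma rk_less:
  assumes "x \<in> P" "y \<in> P" "le y x" "y \<noteq> x"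
  shows "rk y < rk x"
proof -
  obtain f where f: "chart f x"
    using chart_exists assms(1) by blast
  have "y \<in> down x" "x \<in> down x"
    using assms le_refl by (auto simp: down_iff)
  then show ?thesis
    using chart_rank[OF f] chart_rank[OF chart_below[OF f]] chart_mem[OF f] chart_inj[OF f] assms(4)
    by (metis cub_rank_less)
qed

lemma sum_down:
  assumes "x \<in> P"
  shows "(\<Sum>y\<in>down x. l (rk y)) = evalw l (cube_poly r (rk x))"
proof -
  obtain f where f: "chart f x"
    using chart_exists assms by blast
  have "(\<Sum>y\<in>down x. l (rk y)) = (\<Sum>y\<in>down x. l (cub_rank (f y)))"
    by (intro sum.cong refl arg_cong[where f = l] chart_rank chart_below[OF f])
  also have "\<dots> = (\<Sum>c\<in>ideal_below cub_le (C_inf r) (f x). l (cub_rank c))"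
    using f by (intro sum.reindex_bij_betw) (simp add: chart_def)
  also have "\<dots> = evalw l (cube_poly r (rk x))"
    using sum_cube f chart_rank[OF f] by (simp add: chart_def)
  finally show ?thesis .
qed

section \<open>Chain sums of rank-selected subposets through weights\<close>

text \<open>Induction on the rank of \<open>x\<close>. Sorting chains by their top turns the chain
  sum below \<open>x\<close> into a sum of weights; as weights vanish off \<open>S\<close>, this sum
  extends to the whole cube below \<open>x\<close> without its top, where it depends on the rank
  alone.\<close>

lemma rank_weight_eq_chain_sum:
  fixes S z
  defines "PS \<equiv> rank_selected r le P S"
  assumes "x \<in> P"
  shows "rank_weight r z S (rk x) = (if rk x \<in> S then z * chain_sum le (strictly_below le PS x) z else 0)"
  using assms(2)
proof (induction "rk x" arbitrary: x rule: less_induct)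
  case less
  let ?w = "\<lambda>y. rank_weight r z S (rk y)"
  let ?B = "strictly_below le PS x"
  have PS: "PS \<subseteq> P"
    by (auto simp: PS_def rank_selected_def)
  have B: "?B \<subseteq> P"
    using PS by (auto simp: strictly_below_def)
  have "chain_sum le ?B z = 1 + (\<Sum>y\<in>?B. z * chain_sum le (strictly_below le ?B y) z)"
    by (rule chain_sum_rec[OF finite_poset_subset[OF poset B]])
  also have "(\<Sum>y\<in>?B. z * chain_sum le (strictly_below le ?B y) z) = (\<Sum>y\<in>?B. ?w y)"
  proof (rule sum.cong)
    fix y assume y: "y \<in> ?B"
    then have y': "y \<in> P" "rk y \<in> S" "le y x" "y \<noteq> x"
      by (auto simp: strictly_below_def PS_def rank_selected_def)
    have "strictly_below le ?B y = strictly_below le PS y"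
      by (rule strictly_below_idem[OF PS less.prems y])
    then show "z * chain_sum le (strictly_below le ?B y) z = ?w y"
      using less.hyps[of y] rk_less[of x y] y' less.prems by simp
  qed simp
  also have "(\<Sum>y\<in>?B. ?w y) = (\<Sum>y\<in>down x - {x}. ?w y)"
  proof (rule sum.mono_neutral_left)
    show "finite (down x - {x})"
      using finite_P by (simp add: ideal_below_def)
    show "?B \<subseteq> down x - {x}"
      using PS by (auto simp: strictly_below_def down_iff)
    have "y \<in> ?B" if "y \<in> down x - {x}" "rk y \<in> S" for y
      using that by (simp add: strictly_below_def down_iff PS_def rank_selected_def)
    then show "\<forall>y\<in>down x - {x} - ?B. ?w y = 0"
      using rank_weight.simps by (metis Diff_iff)
  qed
  also have "\<dots> = evalw (rank_weight r z S) (cube_poly r (rk x)) - ?w x"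
    using sum_down[OF less.prems, of "rank_weight r z S"] less.prems le_refl finite_P
    by (subst sum_diff1) (auto simp: down_iff ideal_below_def)
  finally show ?case
    by (subst rank_weight_eq) simp
qed

lemma chain_sum_rank_selected:
  "chain_sum le (rank_selected r le P S) z = 1 + (\<Sum>x\<in>P. rank_weight r z S (rk x))"
proof -
  let ?PS = "rank_selected r le P S"
  have PS: "?PS \<subseteq> P"
    by (auto simp: rank_selected_def)
  have "chain_sum le ?PS z = 1 + (\<Sum>x\<in>?PS. z * chain_sum le (strictly_below le ?PS x) z)"
    by (rule chain_sum_rec[OF finite_poset_subset[OF poset PS]])
  also have "(\<Sum>x\<in>?PS. z * chain_sum le (strictly_below le ?PS x) z) = (\<Sum>x\<in>?PS. rank_weight r z S (rk x))"
    using rank_weight_eq_chain_sum PS by (intro sum.cong) (auto simp: rank_selected_def)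
  also have "\<dots> = (\<Sum>x\<in>P. rank_weight r z S (rk x))"
    using finite_P by (intro sum.mono_neutral_left) (auto simp: rank_selected_def rank_weight.simps)
  finally show ?thesis .
qed

section \<open>Saturated chains and the common rank of the facets\<close>

text \<open>Fixing one free coordinate to \<open>Atom 1\<close> lowers the rank by one; without free
  coordinates the step leads to the least element.\<close>

lemma rk_cover:
  assumes x: "x \<in> P" and n: "rk x = Suc n"
  obtains y where "y \<in> P" "le y x" "rk y = n"
proof -
  obtain f where f: "chart f x"
    using chart_exists x by blast
  obtain \<xi> where \<xi>: "f x = Seq \<xi>" "card (zset \<xi>) = n"
    using n chart_rank[OF f] by (cases "f x") (auto simp: zset_def)
  have C: "Seq \<xi> \<in> C_inf r"
    using f \<xi> by (simp add: chart_def)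
  obtain c where c: "c \<in> C_inf r" "cub_le c (f x)" "cub_rank c = n"
  proof (cases "zset \<xi> = {}")
    case True
    then show ?thesis
      using that[of Bot] \<xi> by (simp add: C_inf_Bot)
  next
    case False
    then obtain i where i: "i \<in> zset \<xi>" by blast
    let ?\<eta> = "\<xi>(i := Atom 1)"
    have z: "zset ?\<eta> = zset \<xi> - {i}"
      by (auto simp: zset_def)
    have "Seq ?\<eta> \<in> C_inf r \<and> cub_le (Seq ?\<eta>) (Seq \<xi>)"
      unfolding Seq_le_Seq[OF C] using C i r_pos by (auto simp: C_inf_Seq M_def)
    moreover have "cub_rank (Seq ?\<eta>) = n"
      unfolding cub_rank_Seq z using \<xi>(2) i C card_Suc_Diff1[of "zset \<xi>" i] by (simp only: C_inf_Seq)
    ultimately show ?thesis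
      using that[of "Seq ?\<eta>"] \<xi>(1) by simp
  qed
  then obtain y where y: "y \<in> down x" "f y = c"
    using chart_surj[OF f] by blast
  then show ?thesis
    using that[of y] c chart_rank[OF chart_below[OF f y(1)]] by (simp add: down_iff)
qed

lemma long_chain:
  assumes "x \<in> P"
  obtains C where "pred_on.chain P le C" "x \<in> C" "card C = Suc (rk x)" "\<And>y. y \<in> C \<Longrightarrow> le y x"
  using assms
proof (induction "rk x" arbitrary: x thesis)
  case 0
  then show ?case
    using le_refl by (intro 0(2)[of "{x}"]) (auto simp: chain_iff)
next
  case (Suc n)
  obtain y where y: "y \<in> P" "le y x" "rk y = n"
    using rk_cover Suc.hyps(2) Suc.prems(2) by metis
  obtain C where C: "pred_on.chain P le C" "y \<in> C" "card C = Suc (rk y)" "\<And>w. w \<in> C \<Longrightarrow> le w y"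
    using Suc.hyps(1)[of y] y by metis
  have CP: "C \<subseteq> P"
    using C(1) by (simp add: chain_iff)
  have le: "le w x" if "w \<in> C" for w
    using C(4)[OF that] that CP y Suc.prems(2) le_trans by blast
  have "x \<noteq> y"
    using y Suc.hyps(2) by auto
  then have "x \<notin> C"
    using C(4)[of x] y Suc.prems(2) le_antisym by blast
  moreover have "finite C"
    using CP finite_P finite_subset by blast
  ultimately have "card (insert x C) = Suc (rk x)"
    using C(3) y(3) Suc.hyps(2) by simp
  moreover have "pred_on.chain P le (insert x C)"
    using C(1) le Suc.prems(2) by (auto simp: chain_iff)
  ultimately show ?case
    using le le_refl Suc.prems(2) by (intro Suc.prems(1)[of "insert x C"]) auto
qed

text \<open>A chain of \<open>rk x + 1\<close> elements up to a facet \<open>x\<close> is maximal: a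
  larger chain would still lie below \<open>x\<close>, and the rank is injective on it with values
  at most \<open>rk x\<close>. Purity then compares the sizes for two facets.\<close>

lemma facets_same_rank:
  assumes "pure le P" "x \<in> facets le P" "y \<in> facets le P"
  shows "rk x = rk y"
proof -
  have "\<exists>C. pred_on.maxchain P le C \<and> card C = Suc (rk x)" if x: "x \<in> facets le P" for x
  proof -
    have xP: "x \<in> P" and top: "\<And>w. w \<in> P \<Longrightarrow> le x w \<Longrightarrow> w = x"
      using x by (auto simp: facets_def)
    obtain C where C: "pred_on.chain P le C" "x \<in> C" "card C = Suc (rk x)"
      using long_chain[OF xP] by metis
    have "\<not> (pred_on.chain P le D \<and> C \<subset> D)" for D
    proof
      assume D: "pred_on.chain P le D \<and> C \<subset> D"
      then have DP: "D \<subseteq> P" and tot: "\<And>u w. u \<in> D \<Longrightarrow> w \<in> D \<Longrightarrow> u = w \<or> le u w \<or> le w u"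
        by (auto simp: chain_iff)
      have "x \<in> D"
        using C D by blast
      then have below: "w = x \<or> le w x" if "w \<in> D" for w
        using tot that top DP by blast
      have "inj_on rk D"
      proof (rule inj_onI)
        fix u w assume uw: "u \<in> D" "w \<in> D" "rk u = rk w"
        then have "u \<in> P" "w \<in> P"
          using DP by auto
        then show "u = w"
          using tot[OF uw(1,2)] uw(3) rk_less[of u w] rk_less[of w u] by fastforce
      qed
      moreover have "rk ` D \<subseteq> {..rk x}"
        using below rk_less[OF xP] DP by (fastforce intro: less_imp_le)
      ultimately have "card D \<le> Suc (rk x)"
        using card_inj_on_le[of rk D "{..rk x}"] by simp
      moreover have "card C < card D"
        using D DP finite_P by (meson finite_subset psubset_card_mono)
      ultimately show False
        using C(3) by simp
    qed
    then have "pred_on.maxchain P le C"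
      using C(1) by (auto simp: pred_on.maxchain_def)
    with C(3) show ?thesis by blast
  qed
  then show ?thesis
    using assms unfolding pure_def by (metis nat.inject)
qed

section \<open>Coatoms of a cube and prefixes of its shellings\<close>

lemma chart_self: "chart f x \<Longrightarrow> x \<in> P \<and> x \<in> down x \<and> f x \<in> C_inf r"
  unfolding chart_def down_iff using le_refl by blast

text \<open>A sequence strictly below \<open>\<xi>\<close> has an atom \<open>a\<close> at some free
  coordinate \<open>i\<close>, hence lies below \<open>\<xi>(i := Atom a)\<close>, and maximality
  forces equality. \<open>Bot\<close> is maximal only when no coordinate is free.\<close>

lemma facet_coordinates:
  assumes f: "chart f x" "f x = Seq \<xi>" and c: "c \<in> facets le (strictly_below le P x)"
  shows "c \<in> down x"
    and "(zset \<xi> = {} \<and> f c = Bot) \<or> (\<exists>i\<in>zset \<xi>. \<exists>a\<in>{1..r}. f c = Seq (\<xi>(i := Atom a)))"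
proof -
  have c': "c \<in> down x" "c \<noteq> x"
    using c by (auto simp: facets_def strictly_below_def down_iff)
  then show "c \<in> down x" by simp
  have x: "x \<in> down x" and \<xi>: "Seq \<xi> \<in> C_inf r"
    using chart_self[OF f(1)] f(2) by simp_all
  have max: "f c = d" if d: "d \<in> C_inf r" "cub_le d (Seq \<xi>)" "d \<noteq> Seq \<xi>" "cub_le (f c) d" for d
  proof -
    obtain y where y: "y \<in> down x" "f y = d"
      using chart_surj[OF f(1) d(1)] d(2) f(2) by metis
    then have "y \<in> strictly_below le P x"
      using d f(2) by (auto simp: strictly_below_def down_iff)
    moreover have "le c y"
      using chart_le[OF f(1) c'(1) y(1)] y(2) d(4) by simp
    ultimately show ?thesis
      using c y(2) by (auto simp: facets_def)
  qed
  have fc: "f c \<in> C_inf r" "cub_le (f c) (Seq \<xi>)" "f c \<noteq> Seq \<xi>"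
    using chart_mem[OF f(1) c'(1)] chart_inj[OF f(1) c'(1) x] c'(2) f(2) by auto
  show "(zset \<xi> = {} \<and> f c = Bot) \<or> (\<exists>i\<in>zset \<xi>. \<exists>a\<in>{1..r}. f c = Seq (\<xi>(i := Atom a)))"
  proof (cases "f c")
    case Bot
    have "zset \<xi> = {}"
    proof (rule ccontr)
      assume "zset \<xi> \<noteq> {}"
      then obtain i where i: "i \<in> zset \<xi>" by blast
      have "\<xi>(i := Atom 1) \<noteq> \<xi>"
        using i by (auto simp: zset_def fun_eq_iff)
      then show False
        using max[of "Seq (\<xi>(i := Atom 1))"] C_inf_upd[OF \<xi> i, of 1] r_pos Bot by simp
    qed
    with Bot show ?thesis by simp
  next
    case (Seq \<eta>)
    have \<eta>: "\<forall>i. if i \<in> zset \<xi> then \<eta> i \<in> M r else \<eta> i = \<xi> i"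
      using Seq_le_Seq[OF \<xi>, of \<eta>] fc Seq by simp
    obtain i where ne: "\<eta> i \<noteq> \<xi> i"
      using fc(3) Seq by (auto simp: fun_eq_iff)
    then have i: "i \<in> zset \<xi>" "\<eta> i \<in> M r"
      using \<eta>[rule_format, of i] by (auto split: if_splits)
    then obtain a where a: "\<eta> i = Atom a" "a \<in> {1..r}"
      using ne by (auto simp: M_def zset_def)
    have "cub_le (Seq \<eta>) (Seq (\<xi>(i := Atom a)))"
      using fc(2) Seq a(1) by (simp add: letter_le_def)
    moreover have "\<xi>(i := Atom a) \<noteq> \<xi>"
      using i by (auto simp: zset_def fun_eq_iff)
    ultimately have "f c = Seq (\<xi>(i := Atom a))"
      using max[of "Seq (\<xi>(i := Atom a))"] C_inf_upd[OF \<xi> i(1) a(2)] Seq by simp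
    with i a show ?thesis by blast
  qed
qed

text \<open>Inside the last coatom \<open>c\<close> of the prefix, say in direction \<open>i\<close>, the facets of its intersection
  with the earlier coatoms use in each direction \<open>k \<noteq> i\<close> the same atoms as the prefix itself, so
  induction on the dimension applies to the cube below \<open>c\<close>.\<close>

lemma shelling_prefix_valid:
  assumes "chart f x" "f x = Seq \<xi>"
    and "C_shelling le (strictly_below le P x) (ys @ zs)" "ys \<noteq> []"
  shows "valid_prefix r (f ` set ys) \<xi>"
  using assms
proof (induction "card (zset \<xi>)" arbitrary: x \<xi> ys zs rule: less_induct)
  case less
  note f = less.prems(1,2)
  let ?Q = "strictly_below le P x"
  let ?I = "zset \<xi>"
  have x: "x \<in> P" "x \<in> down x" and \<xi>: "Seq \<xi> \<in> C_inf r"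
    using chart_self[OF f(1)] f(2) by simp_all
  have fin: "finite ?I"
    using \<xi> by (simp add: C_inf_Seq)
  have QP: "?Q \<subseteq> P"
    by (auto simp: strictly_below_def)
  have facets: "distinct (ys @ zs)" "set (ys @ zs) = facets le ?Q"
    using C_shelling_facets[OF less.prems(3)] by auto
  obtain ys' c where ys: "ys = ys' @ [c]"
    using less.prems(4) by (cases ys rule: rev_cases) auto
  have Q: "y \<in> ?Q \<longleftrightarrow> y \<in> down x \<and> f y \<noteq> Seq \<xi>" for y
    using chart_inj[OF f(1) _ x(2), of y] f(2) by (auto simp: strictly_below_def down_iff)
  show ?case
  proof (cases "?I = {}")
    case True
    then show ?thesis by (simp add: valid_prefix_def)
  next
    case False
    have coord: "y \<in> down x \<and> (\<exists>i\<in>?I. \<exists>a\<in>{1..r}. f y = Seq (\<xi>(i := Atom a)))" if "y \<in> set ys" for y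
      using facet_coordinates[OF f, of y] False facets(2) that by auto
    obtain i a where i: "i \<in> ?I" and a: "a \<in> {1..r}" and fc: "f c = Seq (\<xi>(i := Atom a))"
      and c: "c \<in> down x"
      using coord[of c] ys by auto
    have ai: "a \<in> chosen_atoms r (f ` set ys) \<xi> i"
      using a fc ys by (auto simp: chosen_atoms_def)
    \<comment> \<open>Two base cases: a single coatom is alone in its direction, and if only one
      direction is free, \<open>c\<close> meets it. Otherwise the cube below \<open>c\<close> is
      treated by induction.\<close>
    consider "ys' = []" | "?I = {i}" | "ys' \<noteq> []" "?I \<noteq> {i}" by blast
    then show ?thesis
    proof cases
      case 1
      have "chosen_atoms r (f ` set ys) \<xi> i = {a}"
        using a fc Seq_upd_inj[OF i i] by (auto simp: chosen_atoms_def ys 1)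
      with i show ?thesis
        unfolding valid_prefix_def by (metis is_singletonI is_singleton_altdef)
    next
      case 2
      with ai show ?thesis by (auto simp: valid_prefix_def)
    next
      case 3
      define \<zeta> where "\<zeta> = \<xi>(i := Atom a)"
      have z\<zeta>: "zset \<zeta> = ?I - {i}"
        by (simp add: \<zeta>_def zset_upd)
      have f': "chart f c" "f c = Seq \<zeta>"
        using chart_below[OF f(1) c] fc by (auto simp: \<zeta>_def)
      have \<zeta>: "Seq \<zeta> \<in> C_inf r"
        using chart_self[OF f'(1)] f'(2) by simp
      have z\<zeta>0: "zset \<zeta> \<noteq> {}"
        using 3 i z\<zeta> by blast
      have cQ: "c \<in> ?Q"
        using c fc i by (auto simp: Q zset_def fun_eq_iff)
      \<comment> \<open>This makes (S2) available. A chain of \<open>rk c + 1\<close> elements ends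
        at \<open>c\<close>, and \<open>rk c\<close> is at least 2 because \<open>\<zeta>\<close>
        still has a free coordinate.\<close>
      have "poset_rank le ?Q \<ge> 2"
      proof -
        obtain C where C: "pred_on.chain P le C" "card C = Suc (rk c)" "\<And>y. y \<in> C \<Longrightarrow> le y c"
          using long_chain[of c] c by (auto simp: down_iff)
        have "C \<subseteq> ?Q"
        proof
          fix y assume y: "y \<in> C"
          then have "y \<in> P" "le y c"
            using C by (auto simp: chain_iff)
          moreover have "c \<in> P" "le c x" "c \<noteq> x"
            using cQ by (auto simp: strictly_below_def)
          ultimately show "y \<in> ?Q"
            using le_trans[of y c x] le_antisym[of c x] x by (auto simp: strictly_below_def)
        qed
        then have "pred_on.chain ?Q le C"
          using C(1) by (simp add: chain_iff)
        then have "Suc (rk c) \<le> Suc (poset_rank le ?Q)"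
          using chain_card_le[of ?Q le C] C(2) finite_subset[OF QP finite_P] by simp
        moreover have "rk c = Suc (card (zset \<zeta>))"
          using chart_rank[OF f'(1)] f'(2) cub_rank_Seq by metis
        moreover have "card (zset \<zeta>) \<noteq> 0"
          using z\<zeta>0 z\<zeta> fin by simp
        ultimately show ?thesis by simp
      qed
      \<comment> \<open>\<open>length ys'\<close> is the position of \<open>c\<close>, so (S2)
        yields a shelling below \<open>c\<close> that starts with the facets of its intersection
        with the earlier coatoms.\<close>
      then obtain ys2 zs2 where
        sh2: "C_shelling le (strictly_below le ?Q c) (ys2 @ zs2)"
        and ys2: "set ys2 = facets le (shelling_intersection le ?Q (ys @ zs) (length ys'))"
        using C_shelling_step[OF less.prems(3), of "length ys'"] 3(1) ys by auto
      define H where "H = shelling_intersection le ?Q (ys @ zs) (length ys')"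
      have H: "w \<in> H \<longleftrightarrow> w \<in> ?Q \<and> le w c \<and> (\<exists>y\<in>set ys'. le w y)" for w
        unfolding H_def by (subst shelling_intersection_iff) (auto simp: ys)
      have sh2': "C_shelling le (strictly_below le P c) (ys2 @ zs2)"
        using sh2 strictly_below_idem[OF order_refl x(1) cQ] by simp
      have ys': "y \<in> down x" if "y \<in> set ys'" for y
        using coord[of y] that ys by simp
      have HP: "H \<subseteq> P"
        using H QP by blast
      have above: "\<exists>g\<in>set ys2. le w g" if "w \<in> H" for w
        using finite_poset_maximal_above[OF poset HP that] ys2
        unfolding H_def[symmetric] facets_def by blast
      have H_mem: "w \<in> H" if "w \<in> down x" "cub_le (f w) (Seq \<zeta>)" "y \<in> set ys'" "cub_le (f w) (f y)" for w y
      proof -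
        have "le w c" "le w y"
          using chart_le[OF f(1) that(1)] c ys' that f'(2) by auto
        moreover have "f w \<noteq> Seq \<xi>"
        proof
          assume "f w = Seq \<xi>"
          then have "letter_le (\<xi> i) (\<zeta> i)"
            using that(2) by simp
          then show False
            using i by (simp add: \<zeta>_def zset_def letter_le_def)
        qed
        ultimately show ?thesis
          using that by (auto simp: H Q)
      qed
      obtain b where b: "b \<in> down x" "f b = Bot"
        using chart_surj[OF f(1) C_inf_Bot] by auto
      \<comment> \<open>The least element keeps \<open>H\<close>, and with it the new prefix
        \<open>ys2\<close>, from being empty.\<close>
      have "b \<in> H"
        using H_mem[OF b(1), of "hd ys'"] b(2) 3(1) by simp
      then have "ys2 \<noteq> []"
        using above by fastforce
      moreover have "card (zset \<zeta>) < card ?I"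
        unfolding z\<zeta> using i fin by (rule card_Diff1_less[rotated])
      ultimately have IH: "valid_prefix r (f ` set ys2) \<zeta>"
        using less.hyps[OF _ f' sh2'] by blast
      have coord2: "g \<in> down c \<and> (\<exists>k\<in>?I - {i}. \<exists>b\<in>{1..r}. f g = Seq (\<zeta>(k := Atom b)))"
        if "g \<in> set ys2" for g
      proof -
        have "g \<in> facets le (strictly_below le P c)"
          using that C_shelling_facets[OF sh2'] by auto
        then show ?thesis
          using facet_coordinates[OF f', of g] z\<zeta>0 unfolding z\<zeta> by blast
      qed
      have eq: "chosen_atoms r (f ` set ys2) \<zeta> k = chosen_atoms r (f ` set ys) \<xi> k" if k: "k \<in> ?I - {i}" for k
      proof (intro equalityI subsetI)
        fix b assume "b \<in> chosen_atoms r (f ` set ys) \<xi> k"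
        then obtain y where b: "b \<in> {1..r}" and y: "y \<in> set ys" "f y = Seq (\<xi>(k := Atom b))"
          by (auto simp: chosen_atoms_def)
        have "y \<noteq> c"
          using Seq_upd_inj[OF i, of k a b] k y(2) fc by auto
        with y ys have y': "y \<in> set ys'" by simp
        have k': "k \<in> zset \<zeta>"
          using k z\<zeta> by simp
        have le\<xi>: "cub_le (Seq (\<zeta>(k := Atom b))) (Seq \<xi>)"
          using C_inf_upd(2)[OF \<zeta> k' b] C_inf_upd(2)[OF \<xi> i a] cub_le_trans by (metis \<zeta>_def)
        \<comment> \<open>\<open>m\<close> is the meet of the coatoms \<open>c\<close> and
          \<open>y\<close>, with both coordinates \<open>i\<close> and \<open>k\<close>
          fixed.\<close>
        obtain m where m: "m \<in> down x" "f m = Seq (\<zeta>(k := Atom b))"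
          using chart_surj[OF f(1) C_inf_upd(1)[OF \<zeta> k' b]] le\<xi> f(2) by metis
        have "cub_le (f m) (f y)"
          using i k unfolding m(2) y(2) \<zeta>_def by (auto simp: letter_le_def zset_def)
        then have "m \<in> H"
          using H_mem[OF m(1) _ y'] C_inf_upd(2)[OF \<zeta> k' b] m(2) by simp
        then obtain g where g: "g \<in> set ys2" "le m g"
          using above by blast
        obtain k2 b2 where kb: "k2 \<in> ?I - {i}" "f g = Seq (\<zeta>(k2 := Atom b2))" and gc: "g \<in> down c"
          using coord2[OF g(1)] by blast
        have "g \<in> down x"
          using gc down_mono[OF x(1) c] by blast
        then have "cub_le (Seq (\<zeta>(k := Atom b))) (Seq (\<zeta>(k2 := Atom b2)))"
          using chart_le[OF f(1) m(1)] g(2) m(2) kb(2) by simp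
        then have "(\<zeta>(k := Atom b)) k2 = Atom b2"
          by (rule Seq_upd_le_upd)
        moreover have "\<zeta> k2 = Z"
          using kb(1) by (simp add: \<zeta>_def zset_def)
        ultimately have "k2 = k \<and> b2 = b"
          by (simp split: if_splits)
        with g(1) kb(2) b show "b \<in> chosen_atoms r (f ` set ys2) \<zeta> k"
          by (auto simp: chosen_atoms_def intro!: image_eqI[of _ f g])
      next
        fix b assume "b \<in> chosen_atoms r (f ` set ys2) \<zeta> k"
        then obtain g where b: "b \<in> {1..r}" and g: "g \<in> set ys2" "f g = Seq (\<zeta>(k := Atom b))"
          by (auto simp: chosen_atoms_def)
        then have "g \<in> H"
          using ys2 unfolding H_def facets_def by blast
        then obtain y where y: "y \<in> set ys'" "le g y" and gQ: "g \<in> ?Q"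
          by (auto simp: H)
        obtain k2 b2 where kb: "k2 \<in> ?I" "f y = Seq (\<xi>(k2 := Atom b2))"
          using coord[of y] y(1) ys by auto
        have "cub_le (Seq (\<zeta>(k := Atom b))) (Seq (\<xi>(k2 := Atom b2)))"
          using chart_le[OF f(1), of g y] gQ ys'[OF y(1)] y(2) g(2) kb(2) by (simp add: Q)
        then have *: "(\<zeta>(k := Atom b)) k2 = Atom b2"
          by (rule Seq_upd_le_upd)
        \<comment> \<open>Otherwise \<open>y\<close> would fix direction \<open>i\<close> to the
          same atom as \<open>c\<close>, although \<open>c\<close> does not occur in
          \<open>ys'\<close>.\<close>
        have "k2 \<noteq> i"
        proof
          assume "k2 = i"
          then have "f y = f c"
            using * k fc kb(2) by (simp add: \<zeta>_def)
          then have "y = c"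
            using chart_inj[OF f(1) ys'[OF y(1)] c] by simp
          then show False
            using facets(1) y(1) ys by simp
        qed
        then have "k2 = k \<and> b2 = b"
          using * kb(1) by (auto simp: \<zeta>_def zset_def split: if_splits)
        with y(1) kb(2) b ys show "b \<in> chosen_atoms r (f ` set ys) \<xi> k"
          by (auto simp: chosen_atoms_def intro!: image_eqI[of _ f y])
      qed
      \<comment> \<open>Direction \<open>i\<close> is met by \<open>c\<close> itself and all other
        directions keep their chosen atoms, so either alternative passes from \<open>\<zeta>\<close>
        to \<open>\<xi>\<close>.\<close>
      show ?thesis
        using IH ai eq unfolding valid_prefix_def z\<zeta> by (metis Diff_iff empty_iff insert_iff)
    qed
  qed
qed

section \<open>The contribution of a facet attached in a shelling\<close>

text \<open>The lower set \<open>H\<close> is generated by its facets, which are coatoms of the cube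
  below \<open>x\<close>. A sequence therefore lies outside \<open>H\<close> exactly when it avoids
  all chosen atoms, and the least element always belongs to \<open>H\<close>.\<close>

lemma sum_down_minus:
  assumes f: "chart f x" "f x = Seq \<xi>"
    and H: "H \<subseteq> down x" "H \<noteq> {}" "\<And>v w. w \<in> H \<Longrightarrow> v \<in> P \<Longrightarrow> le v w \<Longrightarrow> v \<in> H"
    and facets: "facets le H \<subseteq> facets le (strictly_below le P x)"
  shows "(\<Sum>w\<in>down x - H. l (rk w)) =
    evalw l (q * (\<Prod>i\<in>zset \<xi>. lin (of_nat (r - card (chosen_atoms r (f ` facets le H) \<xi> i)))))"
proof -
  let ?A = "chosen_atoms r (f ` facets le H) \<xi>"
  let ?E = "{\<eta>. Seq \<eta> \<in> C_inf r \<and> cub_le (Seq \<eta>) (Seq \<xi>) \<and> (\<forall>i\<in>zset \<xi>. \<eta> i \<notin> Atom ` ?A i)}"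
  have \<xi>: "Seq \<xi> \<in> C_inf r"
    using chart_self[OF f(1)] f(2) by simp
  have HP: "H \<subseteq> P"
    using H(1) by (auto simp: down_iff)
  have facetsH: "facets le H \<subseteq> H"
    by (auto simp: facets_def)
  have bot: "w \<in> H" if w: "w \<in> down x" "f w = Bot" for w
  proof -
    obtain h where h: "h \<in> H"
      using H(2) by blast
    then have "le w h"
      using chart_le[OF f(1) w(1), of h] w(2) H(1) by auto
    then show ?thesis
      using H(3)[OF h] w(1) by (simp add: down_iff)
  qed
  have seq: "w \<in> H \<longleftrightarrow> (\<exists>i\<in>zset \<xi>. \<eta> i \<in> Atom ` ?A i)" if w: "w \<in> down x" "f w = Seq \<eta>" for w \<eta>
  proof
    assume "w \<in> H"
    then obtain m where m: "m \<in> facets le H" "le w m"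
      using finite_poset_maximal_above[OF poset HP] unfolding facets_def by blast
    then have mx: "m \<in> down x"
      using facetsH H(1) by blast
    have le: "cub_le (Seq \<eta>) (f m)"
      using chart_le[OF f(1) w(1) mx] m(2) w(2) by simp
    then have "f m \<noteq> Bot" by auto
    then obtain i a where i: "i \<in> zset \<xi>" "a \<in> {1..r}" "f m = Seq (\<xi>(i := Atom a))"
      using facet_coordinates(2)[OF f, of m] m(1) facets by blast
    then have "\<eta> i = Atom a"
      using le Seq_upd_le_upd by simp
    moreover have "a \<in> ?A i"
      using i m(1) by (auto simp: chosen_atoms_def intro!: image_eqI[of _ f m])
    ultimately show "\<exists>i\<in>zset \<xi>. \<eta> i \<in> Atom ` ?A i"
      using i(1) by auto
  next
    assume "\<exists>i\<in>zset \<xi>. \<eta> i \<in> Atom ` ?A i"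
    then obtain i a m where i: "i \<in> zset \<xi>" "\<eta> i = Atom a" and m: "m \<in> facets le H" "f m = Seq (\<xi>(i := Atom a))"
      by (auto simp: chosen_atoms_def)
    have mx: "m \<in> down x"
      using facetsH H(1) m(1) by blast
    have "cub_le (Seq \<eta>) (Seq \<xi>)"
      using chart_mem[OF f(1) w(1)] w(2) f(2) by simp
    then have "cub_le (f w) (f m)"
      using i(2) unfolding w(2) m(2) by (simp add: letter_le_def)
    then show "w \<in> H"
      using chart_le[OF f(1) w(1) mx] H(3)[of m w] m(1) facetsH w(1) by (auto simp: down_iff)
  qed
  have "f ` (down x - H) = Seq ` ?E"
  proof (intro equalityI subsetI)
    fix d assume "d \<in> f ` (down x - H)"
    then obtain w where w: "w \<in> down x" "w \<notin> H" "d = f w" by blast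
    then obtain \<eta> where \<eta>: "f w = Seq \<eta>"
      using bot by (cases "f w") auto
    have "\<eta> \<in> ?E"
      using chart_mem[OF f(1) w(1)] seq[OF w(1) \<eta>] w(2) \<eta> f(2) by auto
    then show "d \<in> Seq ` ?E"
      using w(3) \<eta> by blast
  next
    fix d assume "d \<in> Seq ` ?E"
    then obtain \<eta> where \<eta>: "d = Seq \<eta>" "\<eta> \<in> ?E" by blast
    then obtain w where w: "w \<in> down x" "f w = Seq \<eta>"
      using chart_surj[OF f(1), of "Seq \<eta>"] f(2) by auto
    then show "d \<in> f ` (down x - H)"
      using seq[OF w] \<eta> by (auto intro!: image_eqI[of _ f w])
  qed
  moreover have "inj_on f (down x - H)"
    using chart_inj[OF f(1)] by (auto simp: inj_on_def)
  ultimately have "bij_betw f (down x - H) (Seq ` ?E)"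
    by (simp add: bij_betw_def)
  then have "(\<Sum>w\<in>down x - H. l (cub_rank (f w))) = (\<Sum>d\<in>Seq ` ?E. l (cub_rank d))"
    by (rule sum.reindex_bij_betw)
  also have "\<dots> = (\<Sum>\<eta>\<in>?E. l (cub_rank (Seq \<eta>)))"
    by (subst sum.reindex) (auto simp: inj_on_def)
  also have "\<dots> = evalw l (q * (\<Prod>i\<in>zset \<xi>. lin (of_nat (r - card (?A i)))))"
    by (rule sum_cube_avoiding[OF \<xi>]) (auto simp: chosen_atoms_def)
  also have "(\<Sum>w\<in>down x - H. l (cub_rank (f w))) = (\<Sum>w\<in>down x - H. l (rk w))"
    using chart_rank[OF chart_below[OF f(1)]] by (intro sum.cong) auto
  finally show ?thesis .
qed

lemma bottom:
  obtains b where "b \<in> P" "\<And>x. x \<in> P \<Longrightarrow> le b x"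
  using cubical by (auto simp: cubical_def has_least_def)

text \<open>The new elements are those below the facet and outside the intersection
  \<open>H\<close>. Since (S2) makes the facets of \<open>H\<close> a shelling prefix,
  \<open>shelling_prefix_valid\<close> supplies the hypothesis of
  \<open>sector_shelling_piece\<close>.\<close>

lemma sector_new_part:
  fixes z S
  defines "l \<equiv> rank_weight r z S"
  assumes z: "Im z > 0" and sh: "C_shelling le P xs" and j: "0 < j" "j < length xs"
    and d: "rk (xs ! j) = Suc d"
  shows "sector (z / (1 + z)) (piece l r d 0) (\<Sum>w\<in>down (xs ! j) - (\<Union>i<j. down (xs ! i)). l (rk w))"
proof -
  define x where "x = xs ! j"
  define H where "H = shelling_intersection le P xs j"
  have xs: "distinct xs" "set xs = facets le P"
    using C_shelling_facets[OF sh] by auto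
  have facet: "xs ! i \<in> facets le P" if "i < length xs" for i
    using that xs(2) nth_mem by blast
  have xsP: "xs ! i \<in> P" if "i < length xs" for i
    using facet[OF that] by (simp add: facets_def)
  have x: "x \<in> P" "x \<in> facets le P"
    using xsP facet j by (simp_all add: x_def)
  obtain f where f: "chart f x"
    using chart_exists[OF x(1)] .
  obtain \<xi> where \<xi>: "f x = Seq \<xi>" "card (zset \<xi>) = d"
    using chart_rank[OF f] d by (cases "f x") (simp_all add: x_def zset_def)
  have fin: "finite (zset \<xi>)"
    using chart_self[OF f] \<xi>(1) by (simp add: C_inf_Seq)
  have H_eq: "H = down x \<inter> (\<Union>i<j. down (xs ! i))"
    by (simp add: H_def x_def shelling_intersection_def)
  have HP: "H \<subseteq> P"
    by (auto simp: H_eq down_iff)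
  have lower: "v \<in> H" if w: "w \<in> H" "v \<in> P" "le v w" for v w
  proof -
    obtain i where i: "i < j" "w \<in> down (xs ! i)" "w \<in> down x"
      using w(1) by (auto simp: H_eq)
    have "w \<in> P" "v \<in> down w"
      using i(2) w by (auto simp: down_iff)
    then have "v \<in> down x" "v \<in> down (xs ! i)"
      using down_mono[OF x(1) i(3)] down_mono[OF xsP i(2)] i(1) j by auto
    with i(1) show ?thesis
      by (auto simp: H_eq)
  qed
  obtain b where b: "b \<in> P" "\<And>x. x \<in> P \<Longrightarrow> le b x"
    using bottom by blast
  have "xs ! 0 \<in> P"
    using j by (intro xsP) linarith
  then have "b \<in> down (xs ! 0)" "b \<in> down x"
    using b x(1) by (simp_all add: down_iff)
  then have "b \<in> H"
    using j by (auto simp: H_eq)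
  have xH: "x \<notin> H"
  proof
    assume "x \<in> H"
    then obtain i where i: "i < j" "le x (xs ! i)"
      by (auto simp: H_eq down_iff)
    then have "xs ! i = x"
      using x(2) xsP[of i] j by (simp add: facets_def)
    then show False
      using i(1) j xs(1) nth_eq_iff_index_eq[of xs i j] by (simp add: x_def)
  qed
  have facetsH: "facets le H \<noteq> {}"
    using finite_poset_maximal_above[OF poset HP \<open>b \<in> H\<close>] by (auto simp: facets_def)
  have "facets le H \<subseteq> facets le (strictly_below le P x) \<and> valid_prefix r (f ` facets le H) \<xi>"
    using sh
  proof (cases rule: C_shelling.cases)
    case low_rank
    \<comment> \<open>Here the facet has rank 1: no coordinate is free, validity is vacuous, and
      \<open>H\<close> consists of the least element alone.\<close>
    obtain C where "pred_on.chain P le C" "card C = Suc (rk x)"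
      using long_chain[OF x(1)] by blast
    then have "rk x \<le> 1"
      using chain_card_le[OF finite_P] low_rank(6) by fastforce
    then have I: "zset \<xi> = {}"
      using d \<xi>(2) fin by (simp add: x_def)
    have "strictly_below le P x \<subseteq> {b}"
    proof
      fix y assume "y \<in> strictly_below le P x"
      then have y: "y \<in> P" "le y x" "y \<noteq> x"
        by (auto simp: strictly_below_def)
      have "rk b < rk y" if "b \<noteq> y"
        using rk_less[of y b] b y that by simp
      moreover have "rk y < rk x"
        using rk_less[of x y] x(1) y by simp
      ultimately show "y \<in> {b}"
        using \<open>rk x \<le> 1\<close> by auto
    qed
    moreover have "H \<subseteq> strictly_below le P x"
      using xH HP by (auto simp: H_eq strictly_below_def down_iff)
    ultimately have "strictly_below le P x = H"
      using \<open>b \<in> H\<close> by blast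
    with I show ?thesis
      by (simp add: valid_prefix_def)
  next
    case high_rank
    then obtain ys zs where ys: "C_shelling le (strictly_below le P x) (ys @ zs)"
      "set ys = facets le H"
      using j unfolding H_def x_def by blast
    then have "ys \<noteq> []"
      using facetsH by auto
    with shelling_prefix_valid[OF f \<xi>(1) ys(1)] C_shelling_facets[OF ys(1)] ys(2)
    show ?thesis by auto
  qed
  then have sub: "facets le H \<subseteq> facets le (strictly_below le P x)"
    and valid: "valid_prefix r (f ` facets le H) \<xi>"
    by auto
  define a where "a i = card (chosen_atoms r (f ` facets le H) \<xi> i)" for i
  have ch: "chosen_atoms r Y \<eta> i \<subseteq> {1..r}" for Y \<eta> i
    by (auto simp: chosen_atoms_def)
  have a_le: "a i \<le> r" for i
    unfolding a_def using card_mono[OF _ ch] by fastforce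
  have "chosen_atoms r Y \<eta> i \<noteq> {} \<Longrightarrow> card (chosen_atoms r Y \<eta> i) \<ge> 1" for Y \<eta> i
    using finite_subset[OF ch] by (simp add: Suc_le_eq card_gt_0_iff)
  with valid have a_valid: "(\<exists>i\<in>zset \<xi>. a i = 1) \<or> (\<forall>i\<in>zset \<xi>. a i \<ge> 1)"
    unfolding valid_prefix_def a_def by blast
  have "down (xs ! j) - (\<Union>i<j. down (xs ! i)) = down x - H"
    by (auto simp: H_eq x_def)
  moreover have "(\<Sum>w\<in>down x - H. l (rk w)) = evalw l (q * (\<Prod>i\<in>zset \<xi>. lin (of_nat (r - a i))))"
  proof -
    have "H \<subseteq> down x" "H \<noteq> {}"
      using \<open>b \<in> H\<close> by (auto simp: H_eq)
    then show ?thesis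
      unfolding a_def by (rule sum_down_minus[OF f \<xi>(1) _ _ lower sub])
  qed
  ultimately show ?thesis
    using sector_shelling_piece[OF r_pos z fin a_le a_valid, of S] \<xi>(2) by (simp add: l_def)
qed

section \<open>Nonvanishing in the upper half-plane and real-rootedness\<close>

text \<open>Adding the facets in shelling order splits \<open>P\<close> into new parts. In positive
  rank, the first part together with the empty chain is the nonzero first piece, and all other parts
  lie in its sector, so nothing can cancel.\<close>

lemma chain_sum_nonzero:
  assumes z: "Im z > 0" and "C_shellable le P"
  shows "chain_sum le (rank_selected r le P S) z \<noteq> 0"
proof -
  define l where "l = rank_weight r z S"
  obtain xs where pure: "pure le P" and sh: "C_shelling le P xs"
    using assms(2) by (auto simp: C_shellable_def)
  have xs: "distinct xs" "set xs = facets le P"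
    using C_shelling_facets[OF sh] by auto
  have xsP: "xs ! i \<in> P" if "i < length xs" for i
    using that xs(2) nth_mem by (force simp: facets_def)
  have cover: "P = (\<Union>i<length xs. down (xs ! i))"
  proof (intro equalityI subsetI)
    fix y assume y: "y \<in> P"
    obtain m where "m \<in> facets le P" "le y m"
      using finite_poset_maximal_above[OF poset order_refl y] by (auto simp: facets_def)
    with y show "y \<in> (\<Union>i<length xs. down (xs ! i))"
      unfolding xs(2)[symmetric] by (auto simp: in_set_conv_nth down_iff)
  qed (auto simp: down_iff)
  obtain b where b: "b \<in> P" "\<And>x. x \<in> P \<Longrightarrow> le b x"
    using bottom by blast
  then have len: "0 < length xs"
    using cover by (cases xs) auto
  \<comment> \<open>Purity gives all facets the same rank, so every contribution is compared with
    the same first piece.\<close>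
  have rank: "rk (xs ! i) = rk (xs ! 0)" if "i < length xs" for i
    using facets_same_rank[OF pure] xs(2) that len nth_mem by blast
  have fin: "finite (down x)" for x
    using finite_P by (simp add: ideal_below_def)
  define new_part where "new_part j = (\<Sum>w\<in>down (xs ! j) - (\<Union>i<j. down (xs ! i)). l (rk w))" for j
  have total: "chain_sum le (rank_selected r le P S) z = 1 + new_part 0 + (\<Sum>j\<in>{1..<length xs}. new_part j)"
  proof -
    have "(\<Sum>x\<in>P. l (rk x)) = (\<Sum>j<length xs. new_part j)"
      unfolding new_part_def by (subst cover, rule sum_disjointed) (rule fin)
    also have "\<dots> = new_part 0 + (\<Sum>j\<in>{1..<length xs}. new_part j)"
      using len by (simp add: lessThan_atLeast0 sum.atLeast_Suc_lessThan)
    finally show ?thesis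
      by (simp add: chain_sum_rank_selected l_def)
  qed
  have new_part0: "new_part 0 = evalw l (cube_poly r (rk (xs ! 0)))"
    using sum_down[OF xsP[OF len]] by (simp add: new_part_def)
  have ev1: "evalw l 1 = l 0"
    using evalw_q_power[of l 0] by simp
  show ?thesis
  proof (cases "rk (xs ! 0)")
    case 0
    \<comment> \<open>A facet of rank 0 is the least element, so it is the only facet and the chain
      sum is \<open>1\<close> or \<open>1 + z\<close>.\<close>
    have "xs ! i = b" if "i < length xs" for i
      using rk_less[of "xs ! i" b] xsP[OF that] b rank[OF that] 0 by fastforce
    then have "\<not> 1 < length xs"
      using len nth_eq_iff_index_eq[OF xs(1), of 0 1] by auto
    then have "length xs = 1"
      using len by linarith
    then have "chain_sum le (rank_selected r le P S) z = 1 + l 0"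
      using total new_part0 0 ev1 by (simp add: cube_poly_def)
    moreover have "1 + l 0 \<noteq> 0"
      using z by (auto simp: l_def rank_weight.simps complex_eq_iff)
    ultimately show ?thesis by simp
  next
    case (Suc d)
    have "1 + new_part 0 = piece l r d 0"
      using new_part0 Suc ev1 by (simp add: cube_poly_def piece_def evalw_add)
    moreover have "sector (z / (1 + z)) (piece l r d 0) (\<Sum>j\<in>{1..<length xs}. new_part j)"
      unfolding new_part_def l_def
      using Suc rank by (intro sector_sum_right sector_new_part[OF z sh]) auto
    ultimately show ?thesis
      unfolding total
      using sector_add_nonzero[OF Im_divide_one_plus[OF z]] piece_sector[OF r_pos z, of S d]
      by (simp add: l_def)
  qed
qed

text \<open>The coefficients are real, so a nonreal zero or its conjugate would be a zero in the
  upper half-plane.\<close>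

lemma real_rooted_rank_selected:
  assumes "C_shellable le P"
  shows "real_rooted (chain_poly le (rank_selected r le P S))"
  unfolding real_rooted_def poly_chain_poly
proof (intro allI impI)
  fix z assume "chain_sum le (rank_selected r le P S) z = 0"
  then have "\<not> Im z > 0" "\<not> Im (cnj z) > 0"
    using chain_sum_nonzero[OF _ assms, of z S] chain_sum_nonzero[OF _ assms, of "cnj z" S]
    by (auto simp: chain_sum_cnj)
  then show "z \<in> \<real>"
    by (simp add: complex_is_Real_iff)
qed

end

theorem corollary8p8:
  fixes r :: nat and le :: "'a \<Rightarrow> 'a \<Rightarrow> bool" and P :: "'a set"
  assumes "r > 0"
    and "cubical r le P"
    and "C_shellable le P"
  shows "real_rooted (chain_poly le P) \<and>
         (\<forall>S :: nat set. real_rooted (chain_poly le (rank_selected r le P S)))"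
proof -
  interpret cubical_poset r le P
    using assms by unfold_locales
  \<comment> \<open>The chain polynomial of \<open>P\<close> itself is the case in which every rank
    is selected.\<close>
  have "rank_selected r le P UNIV = P"
    by (simp add: rank_selected_def)
  then show ?thesis
    using real_rooted_rank_selected[OF assms(3)] by metis
qed

end
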